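(* Let $S$ be a semigroup with a completely simple ideal $K$. (1) $S$ is solvable if and only if $S$ is a nilpotent extension of $K$ and every subgroup of $K$ is solvable. (2) The following are equivalent: $S$ is left nilpotent; $S$ is right nilpotent; $S$ is supernilpotent; $S$ is a nilpotent extension of $K$ and every subgroup of $K$ is nilpotent.
   Context: A semigroup is regarded as an algebra with one binary operation. For an algebra $\mathbf A$, $n\ge 1$ and congruences $\alpha_1,\dots,\alpha_n$, let $M_{\mathbf A}(\alpha_1,\dots,\alpha_n)$ be the subalgebra of $\mathbf A^{\{0,1\}^n}$ (functions $\{0,1\}^n\to A$, operations pointwise) generated by all functions $g$ for which there are $i\in\{1,\dots,n\}$ and $(a,b)\in\alpha_i$ with $g(x_1,\dots,x_n)=a$ if $x_i=0$ and $=b$ if $x_i=1$. The $n$-ary (term condition) commutator $[\alpha_1,\dots,\alpha_n]$ is the smallest congruence $\delta$ of $\mathbf A$ such that every $f\in M_{\mathbf A}(\alpha_1,\dots,\alpha_n)$ satisfies: if $(f(x0),f(x1))\in\delta$ for all $x\in\{0,1\}^{n-1}\setminus\{(1,\dots,1)\}$, then $(f(1,\dots,1,0),f(1,\dots,1,1))\in\delta$ (here $x0,x1$ denote $x$ with $0$, resp. $1$, appended). For $n=2$ this is the binary commutator $[\alpha,\beta]$. Let $1$ denote the total congruence $A^2$ and $0$ the equality relation. Define $[1]^0=1$, $[1]^{k+1}=[[1]^k,[1]^k]$; $(1]^1=1$, $(1]^{k+1}=[1,(1]^k]$; $[1)^1=1$, $[1)^{k+1}=[[1)^k,1]$. For $d\in\mathbb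 N=\{0,1,\dots\}$, $\mathbf A$ is $d$-solvable if $[1]^d=0$, left $d$-nilpotent if $(1]^{d+1}=0$, right $d$-nilpotent if $[1)^{d+1}=0$, $d$-supernilpotent if the $(d+1)$-ary commutator $[1,\dots,1]=0$; it is solvable (left nilpotent, right nilpotent, supernilpotent) if this holds for some $d$. For a semigroup $S$ and $m\ge1$, $S^m=\{a_1\cdots a_m: a_i\in S\}$. $S$ is a nilpotent extension of an ideal $K$ if $S^m\subseteq K$ for some $m\ge 1$. Solvability/nilpotence of groups is in the classical group-theoretic sense. *)

theory Defs
  imports "HOL-Algebra.Solvable_Groups"
begin

definition sg_congruence :: "('a::semigroup_mult) rel \<Rightarrow> bool" where
  "sg_congruence \<theta> \<longleftrightarrow> equiv UNIV \<theta> \<and>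
     (\<forall>a b c d. (a, b) \<in> \<theta> \<longrightarrow> (c, d) \<in> \<theta> \<longrightarrow> (a * c, b * d) \<in> \<theta>)"

text \<open>M_A(alpha_1,...,alpha_n): subalgebra of A^({0,1}^n) generated by the generators.
  Elements of {0,1}^n are boolean lists of length n (only those values matter);
  index i ranges over 0..n-1 (corresponding to 1..n in the paper).\<close>

inductive_set Mgen :: "('a::semigroup_mult) rel list \<Rightarrow> (bool list \<Rightarrow> 'a) set"
  for as :: "'a rel list" where
  gen: "\<lbrakk> i < length as; (a, b) \<in> as ! i \<rbrakk>
        \<Longrightarrow> (\<lambda>x. if x ! i then b else a) \<in> Mgen as"
| mult: "\<lbrakk> f \<in> Mgen as; g \<in> Mgen as \<rbrakk> \<Longrightarrow> (\<lambda>x. f x * g x) \<in> Mgen as"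

definition TC_holds :: "('a::semigroup_mult) rel list \<Rightarrow> 'a rel \<Rightarrow> bool" where
  "TC_holds as \<delta> \<longleftrightarrow> (\<forall>f \<in> Mgen as.
     (\<forall>x. length x = length as - 1 \<and> x \<noteq> replicate (length as - 1) True \<longrightarrow>
          (f (x @ [False]), f (x @ [True])) \<in> \<delta>) \<longrightarrow>
     (f (replicate (length as - 1) True @ [False]),
      f (replicate (length as - 1) True @ [True])) \<in> \<delta>)"

definition commutator :: "('a::semigroup_mult) rel list \<Rightarrow> 'a rel" where
  "commutator as = \<Inter>{\<delta>. sg_congruence \<delta> \<and> TC_holds as \<delta>}"

abbreviation bcomm :: "('a::semigroup_mult) rel \<Rightarrow> 'a rel \<Rightarrow> 'a rel" where
  "bcomm \<alpha> \<beta> \<equiv> commutator [\<alpha>, \<beta>]"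

fun derived_pow :: "nat \<Rightarrow> ('a::semigroup_mult) rel" where
  "derived_pow 0 = UNIV"
| "derived_pow (Suc k) = bcomm (derived_pow k) (derived_pow k)"

fun left_pow :: "nat \<Rightarrow> ('a::semigroup_mult) rel" where
  "left_pow 0 = UNIV"   (* unused; index starts at 1 *)
| "left_pow (Suc 0) = UNIV"
| "left_pow (Suc (Suc k)) = bcomm UNIV (left_pow (Suc k))"

fun right_pow :: "nat \<Rightarrow> ('a::semigroup_mult) rel" where
  "right_pow 0 = UNIV"  (* unused; index starts at 1 *)
| "right_pow (Suc 0) = UNIV"
| "right_pow (Suc (Suc k)) = bcomm (right_pow (Suc k)) UNIV"

definition sg_solvable :: "'a::semigroup_mult itself \<Rightarrow> bool" where
  "sg_solvable _ \<longleftrightarrow> (\<exists>d. (derived_pow d :: 'a rel) = Id)"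

definition sg_left_nilpotent :: "'a::semigroup_mult itself \<Rightarrow> bool" where
  "sg_left_nilpotent _ \<longleftrightarrow> (\<exists>d. (left_pow (Suc d) :: 'a rel) = Id)"

definition sg_right_nilpotent :: "'a::semigroup_mult itself \<Rightarrow> bool" where
  "sg_right_nilpotent _ \<longleftrightarrow> (\<exists>d. (right_pow (Suc d) :: 'a rel) = Id)"

definition sg_supernilpotent :: "'a::semigroup_mult itself \<Rightarrow> bool" where
  "sg_supernilpotent _ \<longleftrightarrow>
     (\<exists>d. (commutator (replicate (Suc d) UNIV) :: 'a rel) = Id)"

definition sg_ideal :: "('a::semigroup_mult) set \<Rightarrow> bool" where
  "sg_ideal K \<longleftrightarrow> K \<noteq> {} \<and> (\<forall>s k. k \<in> K \<longrightarrow> s * k \<in> K \<and> k * s \<in> K)"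

definition ideal_of :: "('a::semigroup_mult) set \<Rightarrow> 'a set \<Rightarrow> bool" where
  "ideal_of K I \<longleftrightarrow> I \<noteq> {} \<and> I \<subseteq> K \<and> (\<forall>s\<in>K. \<forall>k\<in>I. s * k \<in> I \<and> k * s \<in> I)"

definition idempotent :: "'a::semigroup_mult \<Rightarrow> bool" where
  "idempotent e \<longleftrightarrow> e * e = e"

text \<open>Completely simple: a simple semigroup (no proper ideals) containing a
  primitive idempotent (an idempotent minimal w.r.t. the natural partial order
  f \<le> e iff f = e f = f e, among idempotents of K).\<close>
definition completely_simple :: "('a::semigroup_mult) set \<Rightarrow> bool" where
  "completely_simple K \<longleftrightarrow> K \<noteq> {} \<and> (\<forall>a\<in>K. \<forall>b\<in>K. a * b \<in> K) \<and>
     (\<forall>I. ideal_of K I \<longrightarrow> I = K) \<and>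
     (\<exists>e\<in>K. idempotent e \<and>
        (\<forall>f\<in>K. idempotent f \<and> f = e * f \<and> f = f * e \<longrightarrow> f = e))"

fun sg_power :: "nat \<Rightarrow> ('a::semigroup_mult) set" where
  "sg_power 0 = UNIV"   (* unused; m \<ge> 1 *)
| "sg_power (Suc 0) = UNIV"
| "sg_power (Suc (Suc m)) = {a * b | a b. a \<in> sg_power (Suc m)}"

definition nilpotent_extension :: "('a::semigroup_mult) set \<Rightarrow> bool" where
  "nilpotent_extension K \<longleftrightarrow> (\<exists>m\<ge>1. sg_power m \<subseteq> K)"

text \<open>A subgroup of K: a subset H of K that is a group under the semigroup
  multiplication (with some identity e).\<close>
definition sub_group_monoid :: "('a::semigroup_mult) set \<Rightarrow> 'a \<Rightarrow> 'a monoid" where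
  "sub_group_monoid H e = \<lparr>carrier = H, mult = (\<lambda>x y. x * y), one = e\<rparr>"

fun lower_central :: "('a, 'b) monoid_scheme \<Rightarrow> nat \<Rightarrow> 'a set" where
  "lower_central G 0 = carrier G"
| "lower_central G (Suc k) = generate G
     (\<Union>g \<in> carrier G. \<Union>h \<in> lower_central G k.
        { g \<otimes>\<^bsub>G\<^esub> h \<otimes>\<^bsub>G\<^esub> inv\<^bsub>G\<^esub> g \<otimes>\<^bsub>G\<^esub> inv\<^bsub>G\<^esub> h })"

definition nilpotent_group :: "('a, 'b) monoid_scheme \<Rightarrow> bool" where
  "nilpotent_group G \<longleftrightarrow> (\<exists>k. lower_central G k = {\<one>\<^bsub>G\<^esub>})"

end

theory Submission
  imports Defs
begin

text \<open>
  Fix a primitive idempotent \<open>e\<close> of \<open>K\<close>. Then \<open>e S e\<close> is a group, and an element \<open>w\<close> of \<open>K\<close> is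
  determined by its Rees coordinates: its \<open>\<R>\<close>-class, its \<open>\<L>\<close>-class and \<open>e w e\<close>.

  Sufficiency: the powers of \<open>S\<close> give a central chain of Rees congruences down to \<open>K\<close>; products of
  many elements act on \<open>K/\<R>\<close> and \<open>K/\<L>\<close> by constant maps, which gives a central chain from \<open>K\<close> to
  the \<open>\<H>\<close>-classes; below that, a normal series of the group \<open>e S e\<close> takes over. For
  supernilpotence, \<open>x \<mapsto> e f(x) e\<close> is a product of group-valued functions each depending on boundedly
  many coordinates, because the \<open>\<R>\<close>- and \<open>\<L>\<close>-class of a long product only depend on its first and
  last few factors. In a nilpotent group, if the derivative of such a function in one
  direction of a large cube is trivial off the top vertex, then it is trivial there too.

  Necessity: if \<open>a'\<close>, \<open>b'\<close> lie in \<open>K\<close> and \<open>f\<close> in \<open>K\<close> satisfies \<open>a' f = a'\<close>, \<open>f b' = b'\<close>, then the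
  term condition for \<open>a' (f b) = a' b\<close> relates \<open>a b\<close> to \<open>a f b \<in> K\<close>; hence long products are related to
  elements of \<open>K\<close> by the iterated commutators. For subgroups, group commutators are terms.
\<close>

subsection \<open>Commutators and the term condition\<close>

lemma sg_congruenceI:
  assumes "\<And>a. (a, a) \<in> \<theta>"
    and "\<And>a b. (a, b) \<in> \<theta> \<Longrightarrow> (b, a) \<in> \<theta>"
    and "\<And>a b c. (a, b) \<in> \<theta> \<Longrightarrow> (b, c) \<in> \<theta> \<Longrightarrow> (a, c) \<in> \<theta>"
    and "\<And>a b s. (a, b) \<in> \<theta> \<Longrightarrow> (s * a, s * b) \<in> \<theta>"
    and "\<And>a b s. (a, b) \<in> \<theta> \<Longrightarrow> (a * s, b * s) \<in> \<theta>"
  shows "sg_congruence \<theta>"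
  unfolding sg_congruence_def
proof (intro conjI allI impI)
  show "equiv UNIV \<theta>"
    by (intro equivI refl_onI symI transI) (auto intro: assms(1) elim: assms(2,3))
  show "(a * c, b * d) \<in> \<theta>" if "(a, b) \<in> \<theta>" "(c, d) \<in> \<theta>" for a b c d
    using assms(3)[OF assms(5)[OF that(1)] assms(4)[OF that(2)]] .
qed

lemma sg_congruenceD:
  assumes "sg_congruence \<theta>"
  shows "(a, a) \<in> \<theta>"
    and "(a, b) \<in> \<theta> \<Longrightarrow> (b, a) \<in> \<theta>"
    and "(a, b) \<in> \<theta> \<Longrightarrow> (b, c) \<in> \<theta> \<Longrightarrow> (a, c) \<in> \<theta>"
    and "(a, b) \<in> \<theta> \<Longrightarrow> (c, d) \<in> \<theta> \<Longrightarrow> (a * c, b * d) \<in> \<theta>"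
    and "(a, b) \<in> \<theta> \<Longrightarrow> (s * a, s * b) \<in> \<theta>"
    and "(a, b) \<in> \<theta> \<Longrightarrow> (a * s, b * s) \<in> \<theta>"
proof -
  have eq: "equiv UNIV \<theta>"
    and c: "\<And>a b c d. (a, b) \<in> \<theta> \<Longrightarrow> (c, d) \<in> \<theta> \<Longrightarrow> (a * c, b * d) \<in> \<theta>"
    using assms unfolding sg_congruence_def by blast+
  show refl: "(a, a) \<in> \<theta>" for a using eq by (simp add: equiv_def refl_on_def)
  show "(a, b) \<in> \<theta> \<Longrightarrow> (b, a) \<in> \<theta>" using eq by (meson equivE symE)
  show "(a, b) \<in> \<theta> \<Longrightarrow> (b, c) \<in> \<theta> \<Longrightarrow> (a, c) \<in> \<theta>" using eq by (meson equivE transE)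
  show "(a, b) \<in> \<theta> \<Longrightarrow> (c, d) \<in> \<theta> \<Longrightarrow> (a * c, b * d) \<in> \<theta>" by (rule c)
  show "(a, b) \<in> \<theta> \<Longrightarrow> (s * a, s * b) \<in> \<theta>" using c refl by blast
  show "(a, b) \<in> \<theta> \<Longrightarrow> (a * s, b * s) \<in> \<theta>" using c refl by blast
qed

lemma sg_congruence_square:
  assumes "sg_congruence \<theta>" "(a, c) \<in> \<theta>" "(b, d) \<in> \<theta>" "(a, b) \<in> \<theta>"
  shows "(c, d) \<in> \<theta>"
  using sg_congruenceD(2,3)[OF assms(1)] assms(2-4) by metis

lemma sg_congruence_UNIV: "sg_congruence UNIV"
  by (rule sg_congruenceI) auto

lemma sg_congruence_Inter:
  assumes "\<And>\<theta>. \<theta> \<in> T \<Longrightarrow> sg_congruence \<theta>" shows "sg_congruence (\<Inter>T)"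
proof (rule sg_congruenceI)
  note T = assms[THEN sg_congruenceD(1)] assms[THEN sg_congruenceD(2)]
    assms[THEN sg_congruenceD(3)] assms[THEN sg_congruenceD(5)] assms[THEN sg_congruenceD(6)]
  fix a b c s
  show "(a, a) \<in> \<Inter>T" using T(1) by (rule InterI)
  assume "(a, b) \<in> \<Inter>T"
  then have ab: "(a, b) \<in> \<theta>" if "\<theta> \<in> T" for \<theta> using that by simp
  show "(b, a) \<in> \<Inter>T" using T(2)[OF _ ab] by (rule InterI)
  show "(s * a, s * b) \<in> \<Inter>T" using T(4)[OF _ ab] by (rule InterI)
  show "(a * s, b * s) \<in> \<Inter>T" using T(5)[OF _ ab] by (rule InterI)
  assume "(b, c) \<in> \<Inter>T"
  then have bc: "(b, c) \<in> \<theta>" if "\<theta> \<in> T" for \<theta> using that by simp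
  show "(a, c) \<in> \<Inter>T" using T(3)[OF _ ab bc] by (rule InterI)
qed

lemma sg_congruence_commutator: "sg_congruence (commutator as)"
  unfolding commutator_def by (rule sg_congruence_Inter) simp

text \<open>The term condition is a Horn clause in \<delta>, so it passes to intersections: the
  intersection in \<open>commutator\<close> belongs to the family itself and is its least
  element.\<close>

lemma TC_holds_commutator: "TC_holds as (commutator as)"
  unfolding commutator_def TC_holds_def by blast

lemma commutator_subset: "sg_congruence \<delta> \<Longrightarrow> TC_holds as \<delta> \<Longrightarrow> commutator as \<subseteq> \<delta>"
  unfolding commutator_def by blast

lemma eq_Id_iff_subset: "sg_congruence \<theta> \<Longrightarrow> \<theta> = Id \<longleftrightarrow> \<theta> \<subseteq> Id"
  using sg_congruenceD(1) by auto

text \<open>\<open>cmat \<alpha> \<beta> a b c d\<close>: the values at \<open>00, 01, 10, 11\<close> of an element of \<open>M(\<alpha>, \<beta>)\<close>.\<close>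

inductive cmat :: "('a::semigroup_mult) rel \<Rightarrow> 'a rel \<Rightarrow> 'a \<Rightarrow> 'a \<Rightarrow> 'a \<Rightarrow> 'a \<Rightarrow> bool"
  for \<alpha> \<beta> :: "'a rel" where
  cmat1: "(a, b) \<in> \<alpha> \<Longrightarrow> cmat \<alpha> \<beta> a a b b"
| cmat2: "(a, b) \<in> \<beta> \<Longrightarrow> cmat \<alpha> \<beta> a b a b"
| cmat_mult: "cmat \<alpha> \<beta> a b c d \<Longrightarrow> cmat \<alpha> \<beta> a' b' c' d' \<Longrightarrow>
    cmat \<alpha> \<beta> (a * a') (b * b') (c * c') (d * d')"

lemma cmat_if_Mgen:
  assumes "f \<in> Mgen [\<alpha>, \<beta>]"
  shows "cmat \<alpha> \<beta> (f [False, False]) (f [False, True]) (f [True, False]) (f [True, True])"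
  using assms
proof (induction rule: Mgen.induct)
  case (gen i a b)
  then consider "i = 0" "(a, b) \<in> \<alpha>" | "i = 1" "(a, b) \<in> \<beta>"
    by (auto simp: less_Suc_eq)
  then show ?case by cases (auto intro: cmat.intros)
next
  case (mult f g)
  then show ?case by (auto intro: cmat.intros)
qed

lemma Mgen_if_cmat:
  assumes "cmat \<alpha> \<beta> a b c d"
  shows "\<exists>f \<in> Mgen [\<alpha>, \<beta>]. f [False, False] = a \<and> f [False, True] = b \<and>
    f [True, False] = c \<and> f [True, True] = d"
  using assms
proof induction
  case (cmat1 a b)
  then show ?case
    using Mgen.gen[of 0 "[\<alpha>, \<beta>]" a b] by (intro bexI[of _ "\<lambda>x. if x ! 0 then b else a"]) auto
next
  case (cmat2 a b)
  then show ?case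
    using Mgen.gen[of 1 "[\<alpha>, \<beta>]" a b] by (intro bexI[of _ "\<lambda>x. if x ! 1 then b else a"]) auto
next
  case (cmat_mult a b c d a' b' c' d')
  then obtain f g where "f \<in> Mgen [\<alpha>, \<beta>]" "g \<in> Mgen [\<alpha>, \<beta>]" and
    "f [False, False] = a" "f [False, True] = b" "f [True, False] = c" "f [True, True] = d"
    "g [False, False] = a'" "g [False, True] = b'" "g [True, False] = c'" "g [True, True] = d'"
    by blast
  then show ?case
    using Mgen.mult[of f "[\<alpha>, \<beta>]" g] by (intro bexI[of _ "\<lambda>x. f x * g x"]) auto
qed

lemma TC_holds_binary_iff:
  "TC_holds [\<alpha>, \<beta>] \<delta> \<longleftrightarrow> (\<forall>a b c d. cmat \<alpha> \<beta> a b c d \<longrightarrow> (a, b) \<in> \<delta> \<longrightarrow> (c, d) \<in> \<delta>)"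
proof -
  have x: "length x = Suc 0 \<and> x \<noteq> [True] \<longleftrightarrow> x = [False]" for x :: "bool list"
    by (cases x) auto
  have "TC_holds [\<alpha>, \<beta>] \<delta> \<longleftrightarrow> (\<forall>f \<in> Mgen [\<alpha>, \<beta>].
    (f [False, False], f [False, True]) \<in> \<delta> \<longrightarrow> (f [True, False], f [True, True]) \<in> \<delta>)"
    unfolding TC_holds_def by (simp add: x)
  also have "\<dots> \<longleftrightarrow> (\<forall>a b c d. cmat \<alpha> \<beta> a b c d \<longrightarrow> (a, b) \<in> \<delta> \<longrightarrow> (c, d) \<in> \<delta>)"
    using cmat_if_Mgen Mgen_if_cmat by metis
  finally show ?thesis .
qed

lemma cmat_bcomm: "cmat \<alpha> \<beta> a b c d \<Longrightarrow> (a, b) \<in> bcomm \<alpha> \<beta> \<Longrightarrow> (c, d) \<in> bcomm \<alpha> \<beta>"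
  using TC_holds_commutator TC_holds_binary_iff by blast

lemma cmat_mono: "cmat \<alpha> \<beta> a b c d \<Longrightarrow> \<alpha> \<subseteq> \<alpha>' \<Longrightarrow> \<beta> \<subseteq> \<beta>' \<Longrightarrow> cmat \<alpha>' \<beta>' a b c d"
  by (induction rule: cmat.induct) (auto intro: cmat.intros)

lemma TC_holds_antimono:
  "TC_holds [\<alpha>', \<beta>'] \<delta> \<Longrightarrow> \<alpha> \<subseteq> \<alpha>' \<Longrightarrow> \<beta> \<subseteq> \<beta>' \<Longrightarrow> TC_holds [\<alpha>, \<beta>] \<delta>"
  unfolding TC_holds_binary_iff using cmat_mono by blast

lemma cmat_transpose: "cmat \<alpha> \<beta> a b c d \<Longrightarrow> cmat \<beta> \<alpha> a c b d"
  by (induction rule: cmat.induct) (auto intro: cmat.intros)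

lemma cmat_rows:
  assumes "cmat \<alpha> \<beta> a b c d" "sg_congruence \<beta>"
  shows "(a, b) \<in> \<beta> \<and> (c, d) \<in> \<beta>"
  using assms by (induction rule: cmat.induct) (auto intro: sg_congruenceD(1,4))

lemma cmat_columns:
  assumes "cmat \<alpha> \<beta> a b c d" "sg_congruence \<alpha>"
  shows "(a, c) \<in> \<alpha> \<and> (b, d) \<in> \<alpha>"
  using cmat_rows[OF cmat_transpose[OF assms(1)] assms(2)] .

text \<open>Both orders of the arguments are demanded because \<open>left_pow\<close> and
  \<open>right_pow\<close> put the total congruence on opposite sides. By antimonotonicity one step
  then lowers the derived series as well.\<close>

definition central_step :: "('a::semigroup_mult) rel \<Rightarrow> 'a rel \<Rightarrow> bool" where
  "central_step \<alpha> \<delta> \<longleftrightarrow>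
     sg_congruence \<delta> \<and> TC_holds [UNIV, \<alpha>] \<delta> \<and> TC_holds [\<alpha>, UNIV] \<delta>"

lemma central_step_left:
  assumes "central_step \<alpha> \<delta>" "left_pow (Suc d) \<subseteq> \<alpha>"
  shows "left_pow (Suc (Suc d)) \<subseteq> \<delta>"
  using assms commutator_subset TC_holds_antimono[of UNIV \<alpha> \<delta> UNIV]
  unfolding central_step_def left_pow.simps by blast

lemma central_step_right:
  assumes "central_step \<alpha> \<delta>" "right_pow (Suc d) \<subseteq> \<alpha>"
  shows "right_pow (Suc (Suc d)) \<subseteq> \<delta>"
  using assms commutator_subset TC_holds_antimono[of \<alpha> UNIV \<delta> _ UNIV]
  unfolding central_step_def right_pow.simps by blast

lemma derived_pow_Suc_subset:
  assumes "sg_congruence \<delta>" "TC_holds [\<alpha>, \<alpha>] \<delta>" "derived_pow d \<subseteq> \<alpha>"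
  shows "derived_pow (Suc d) \<subseteq> \<delta>"
  using commutator_subset[OF assms(1) TC_holds_antimono[OF assms(2,3,3)]] by simp

lemma central_step_derived:
  assumes "central_step \<alpha> \<delta>" "derived_pow d \<subseteq> \<alpha>"
  shows "derived_pow (Suc d) \<subseteq> \<delta>"
  using assms derived_pow_Suc_subset TC_holds_antimono[of UNIV \<alpha> \<delta> \<alpha> \<alpha>]
  unfolding central_step_def by blast

lemma sg_congruence_left_pow: "sg_congruence (left_pow n)"
  by (cases n rule: left_pow.cases) (auto simp: sg_congruence_UNIV sg_congruence_commutator)

lemma sg_congruence_right_pow: "sg_congruence (right_pow n)"
  by (cases n rule: right_pow.cases) (auto simp: sg_congruence_UNIV sg_congruence_commutator)

lemma sg_congruence_derived_pow: "sg_congruence (derived_pow n)"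
  by (cases n) (auto simp: sg_congruence_UNIV sg_congruence_commutator)

text \<open>The three series are followed together, since a single chain of central steps bounds all
  of them.\<close>

definition all_pows_below :: "('a::semigroup_mult) rel \<Rightarrow> bool" where
  "all_pows_below \<alpha> \<longleftrightarrow> (\<exists>d. derived_pow d \<subseteq> \<alpha>) \<and>
     (\<exists>d. left_pow (Suc d) \<subseteq> \<alpha>) \<and> (\<exists>d. right_pow (Suc d) \<subseteq> \<alpha>)"

lemma all_pows_below_UNIV: "all_pows_below UNIV"
  unfolding all_pows_below_def by auto

lemma all_pows_below_mono: "all_pows_below \<alpha> \<Longrightarrow> \<alpha> \<subseteq> \<beta> \<Longrightarrow> all_pows_below \<beta>"
  unfolding all_pows_below_def by blast

lemma all_pows_below_step: "all_pows_below \<alpha> \<Longrightarrow> central_step \<alpha> \<delta> \<Longrightarrow> all_pows_below \<delta>"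
  unfolding all_pows_below_def
  by (metis central_step_left central_step_right central_step_derived)

text \<open>A generator of the matrix algebra is constant along rows or along columns. Every other
  element is a product, and there both rows lie in \<delta>, because a product of two
  \<alpha>-related pairs is \<delta>-related.\<close>

lemma central_step_translate:
  assumes \<alpha>: "sg_congruence \<alpha>" and \<delta>: "sg_congruence \<delta>"
    and l: "\<And>a b s. (a, b) \<in> \<alpha> \<Longrightarrow> (s * a, s * b) \<in> \<delta>"
    and r: "\<And>a b s. (a, b) \<in> \<alpha> \<Longrightarrow> (a * s, b * s) \<in> \<delta>"
  shows "central_step \<alpha> \<delta>"
proof -
  have prod: "(a * a', b * b') \<in> \<delta>" if "(a, b) \<in> \<alpha>" "(a', b') \<in> \<alpha>" for a a' b b'
    using sg_congruenceD(3)[OF \<delta> r[OF that(1)] l[OF that(2)]] .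
  have *: "(a = b \<and> c = d) \<or> (a = c \<and> b = d) \<or> ((a, b) \<in> \<delta> \<and> (c, d) \<in> \<delta>)"
    if "cmat UNIV \<alpha> a b c d" for a b c d
    using that
  proof cases
    case (cmat_mult a b c d a' b' c' d')
    then show ?thesis using prod cmat_rows[OF _ \<alpha>] by blast
  qed auto
  have "TC_holds [UNIV, \<alpha>] \<delta>"
    unfolding TC_holds_binary_iff using * sg_congruenceD(1)[OF \<delta>] by blast
  \<comment> \<open>The same trichotomy for the transposed matrix: when both columns lie in
    \<delta>, \<open>sg_congruence_square\<close> carries \<delta> from the first row to the
    second.\<close>
  moreover have "TC_holds [\<alpha>, UNIV] \<delta>"
    unfolding TC_holds_binary_iff
    using *[OF cmat_transpose] sg_congruenceD(1)[OF \<delta>] sg_congruence_square[OF \<delta>] by blast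
  ultimately show ?thesis using \<delta> unfolding central_step_def by blast
qed

text \<open>A varying factor at the beginning of a product lies in \<open>K\<close> and fixes the \<open>\<delta>\<close>-class of the product;
  any other varying factor is multiplied from the left, which improves \<open>\<alpha>\<close> to \<open>\<delta>\<close>.\<close>

lemma central_step_left_translate:
  assumes \<alpha>: "sg_congruence \<alpha>" and \<delta>: "sg_congruence \<delta>"
    and K: "\<And>a b. (a, b) \<in> \<alpha> \<Longrightarrow> a = b \<or> a \<in> K \<and> b \<in> K"
    and absorb: "\<And>k c d. k \<in> K \<Longrightarrow> (k * c, k * d) \<in> \<delta>"
    and l: "\<And>a b s. (a, b) \<in> \<alpha> \<Longrightarrow> (s * a, s * b) \<in> \<delta>"
  shows "central_step \<alpha> \<delta>"
proof -
  \<comment> \<open>The second alternative lets the columns be continued by different factors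
    \<open>s\<close> and \<open>t\<close>. So a left factor of this kind settles the columns of any
    product that it begins.\<close>
  define I where "I a b c d \<longleftrightarrow> (a, b) \<in> \<delta> \<and> (c, d) \<in> \<delta> \<or>
      (a, c) \<in> \<delta> \<and> (b, d) \<in> \<delta> \<and> (\<forall>s t. (a * s, c * t) \<in> \<delta> \<and> (b * s, d * t) \<in> \<delta>)"
    for a b c d
  have *: "I a b c d" if "cmat UNIV \<alpha> a b c d" for a b c d
    using that
  proof induction
    case (cmat1 a b)
    then show ?case using sg_congruenceD(1)[OF \<delta>] by (simp add: I_def)
  next
    case (cmat2 a b)
    then show ?case using K[OF cmat2] absorb sg_congruenceD(1)[OF \<delta>] unfolding I_def by auto
  next
    case (cmat_mult a b c d a' b' c' d')
    from cmat_mult(3)[unfolded I_def] show ?case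
    proof
      assume "(a, b) \<in> \<delta> \<and> (c, d) \<in> \<delta>"
      then have "(a * a', b * a') \<in> \<delta>" "(c * c', d * c') \<in> \<delta>"
        using sg_congruenceD(6)[OF \<delta>] by auto
      moreover have "(b * a', b * b') \<in> \<delta>" "(d * c', d * d') \<in> \<delta>"
        using l cmat_rows[OF cmat_mult(2) \<alpha>] by auto
      ultimately show ?thesis unfolding I_def using sg_congruenceD(3)[OF \<delta>] by blast
    qed (auto simp: I_def mult.assoc)
  qed
  have "TC_holds [UNIV, \<alpha>] \<delta>"
    unfolding TC_holds_binary_iff using * sg_congruence_square[OF \<delta>] I_def by blast
  moreover have "TC_holds [\<alpha>, UNIV] \<delta>"
    unfolding TC_holds_binary_iff using *[OF cmat_transpose] sg_congruence_square[OF \<delta>] I_def by blast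
  ultimately show ?thesis using \<delta> unfolding central_step_def by blast
qed

text \<open>The mirror image of \<open>central_step_left_translate\<close>: now the last factor of a
  product decides, so the induction splits on the right factor.\<close>

lemma central_step_right_translate:
  assumes \<alpha>: "sg_congruence \<alpha>" and \<delta>: "sg_congruence \<delta>"
    and K: "\<And>a b. (a, b) \<in> \<alpha> \<Longrightarrow> a = b \<or> a \<in> K \<and> b \<in> K"
    and absorb: "\<And>k c d. k \<in> K \<Longrightarrow> (c * k, d * k) \<in> \<delta>"
    and r: "\<And>a b s. (a, b) \<in> \<alpha> \<Longrightarrow> (a * s, b * s) \<in> \<delta>"
  shows "central_step \<alpha> \<delta>"
proof -
  define I where "I a b c d \<longleftrightarrow> (a, b) \<in> \<delta> \<and> (c, d) \<in> \<delta> \<or>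
      (a, c) \<in> \<delta> \<and> (b, d) \<in> \<delta> \<and> (\<forall>s t. (s * a, t * c) \<in> \<delta> \<and> (s * b, t * d) \<in> \<delta>)"
    for a b c d
  have *: "I a b c d" if "cmat UNIV \<alpha> a b c d" for a b c d
    using that
  proof induction
    case (cmat1 a b)
    then show ?case using sg_congruenceD(1)[OF \<delta>] by (simp add: I_def)
  next
    case (cmat2 a b)
    then show ?case using K[OF cmat2] absorb sg_congruenceD(1)[OF \<delta>] unfolding I_def by auto
  next
    case (cmat_mult a b c d a' b' c' d')
    from cmat_mult(4)[unfolded I_def] show ?case
    proof
      assume "(a', b') \<in> \<delta> \<and> (c', d') \<in> \<delta>"
      then have "(b * a', b * b') \<in> \<delta>" "(d * c', d * d') \<in> \<delta>"
        using sg_congruenceD(5)[OF \<delta>] by auto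
      moreover have "(a * a', b * a') \<in> \<delta>" "(c * c', d * c') \<in> \<delta>"
        using r cmat_rows[OF cmat_mult(1) \<alpha>] by auto
      ultimately show ?thesis unfolding I_def using sg_congruenceD(3)[OF \<delta>] by blast
    qed (auto simp: I_def mult.assoc[symmetric])
  qed
  have "TC_holds [UNIV, \<alpha>] \<delta>"
    unfolding TC_holds_binary_iff using * sg_congruence_square[OF \<delta>] I_def by blast
  moreover have "TC_holds [\<alpha>, UNIV] \<delta>"
    unfolding TC_holds_binary_iff using *[OF cmat_transpose] sg_congruence_square[OF \<delta>] I_def by blast
  ultimately show ?thesis using \<delta> unfolding central_step_def by blast
qed

text \<open>A binary commutator lies below each argument that is a congruence, so all three series
  decrease, and the larger of two indices serves both \<alpha> and \<beta>.\<close>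

lemma all_pows_below_Int:
  assumes "all_pows_below \<alpha>" "all_pows_below \<beta>" shows "all_pows_below (\<alpha> \<inter> \<beta>)"
proof -
  have rows: "commutator [\<alpha>, \<beta>] \<subseteq> \<beta>" if "sg_congruence \<beta>" for \<alpha> \<beta> :: "'a rel"
    using commutator_subset[OF that, of "[\<alpha>, \<beta>]"] cmat_rows[OF _ that]
    unfolding TC_holds_binary_iff by blast
  have columns: "commutator [\<alpha>, \<beta>] \<subseteq> \<alpha>" if "sg_congruence \<alpha>" for \<alpha> \<beta> :: "'a rel"
    using commutator_subset[OF that, of "[\<alpha>, \<beta>]"] cmat_columns[OF _ that] sg_congruence_square[OF that]
    unfolding TC_holds_binary_iff by blast
  have "antimono (derived_pow :: nat \<Rightarrow> 'a rel)"
    by (simp add: antimono_iff_le_Suc rows sg_congruence_derived_pow)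
  moreover have "antimono (\<lambda>d. left_pow (Suc d) :: 'a rel)"
    by (simp add: antimono_iff_le_Suc rows sg_congruence_left_pow)
  moreover have "antimono (\<lambda>d. right_pow (Suc d) :: 'a rel)"
    by (simp add: antimono_iff_le_Suc columns sg_congruence_right_pow)
  moreover have "\<exists>d. P d \<subseteq> \<alpha> \<inter> \<beta>"
    if "antimono P" "P i \<subseteq> \<alpha>" "P j \<subseteq> \<beta>" for P :: "nat \<Rightarrow> 'a rel" and i j
    using antimonoD[OF that(1), of i "max i j"] antimonoD[OF that(1), of j "max i j"] that(2,3)
    by (intro exI[of _ "max i j"]) auto
  ultimately show ?thesis using assms unfolding all_pows_below_def by meson
qed

subsection \<open>Powers of a semigroup\<close>

lemma sg_power_Suc_subset: "sg_power (Suc (Suc k)) \<subseteq> sg_power (Suc k)"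
  by (induction k) auto

lemma sg_power_mult_right: "a \<in> sg_power (Suc k) \<Longrightarrow> a * s \<in> sg_power (Suc (Suc k))"
  by auto

lemma sg_power_mult_left: "a \<in> sg_power (Suc k) \<Longrightarrow> s * a \<in> sg_power (Suc (Suc k))"
proof (induction k arbitrary: a)
  case (Suc k)
  then obtain b c where "a = b * c" "b \<in> sg_power (Suc k)" by auto
  then show ?case using sg_power_mult_right[OF Suc.IH, of b c] by (metis mult.assoc)
qed auto

lemma sg_power_split:
  "s \<in> sg_power (Suc k + Suc l) \<Longrightarrow> \<exists>a b. s = a * b \<and> a \<in> sg_power (Suc k) \<and> b \<in> sg_power (Suc l)"
proof (induction l arbitrary: s)
  case 0
  then show ?case by auto
next
  case (Suc l)
  then obtain c d where "s = c * d" "c \<in> sg_power (Suc k + Suc l)" by auto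
  then show ?case using Suc.IH[of c] sg_power_mult_right[of _ l d] by (metis mult.assoc)
qed

definition rees :: "('a::semigroup_mult) set \<Rightarrow> 'a rel" where
  "rees I = Id \<union> I \<times> I"

lemma sg_congruence_rees:
  assumes "\<And>s k. k \<in> I \<Longrightarrow> s * k \<in> I" "\<And>s k. k \<in> I \<Longrightarrow> k * s \<in> I"
  shows "sg_congruence (rees I)"
  using assms by (intro sg_congruenceI) (auto simp: rees_def)

text \<open>Multiplication by any element, on either side, moves a power of the semigroup into the
  next one. Hence consecutive Rees congruences satisfy
  \<open>central_step_translate\<close>.\<close>

lemma all_pows_below_rees_power: "all_pows_below (rees (sg_power (Suc k)))"
proof (induction k)
  case 0
  then show ?case using all_pows_below_UNIV by (simp add: rees_def all_pows_below_mono)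
next
  case (Suc k)
  have cong: "sg_congruence (rees (sg_power (Suc k)))" for k
    using sg_power_mult_left sg_power_mult_right sg_power_Suc_subset
    by (intro sg_congruence_rees) blast+
  have "central_step (rees (sg_power (Suc k))) (rees (sg_power (Suc (Suc k))))"
    by (rule central_step_translate[OF cong cong])
      (auto simp: rees_def simp del: sg_power.simps intro: sg_power_mult_left sg_power_mult_right)
  with Suc.IH show ?case by (rule all_pows_below_step)
qed

subsection \<open>Rees coordinates\<close>

text \<open>\<open>J a\<close> is the inverse of \<open>e a e\<close> in the group \<open>e S e\<close>. The Rees coordinates of \<open>w \<in> K\<close> are
  \<open>w J(w)\<close>, \<open>e w e\<close> and \<open>J(w) w\<close>.\<close>

locale cs_kernel =
  fixes K :: "('a::semigroup_mult) set" and e :: 'a and J :: "'a \<Rightarrow> 'a"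
  assumes K_left: "k \<in> K \<Longrightarrow> s * k \<in> K"
    and K_right: "k \<in> K \<Longrightarrow> k * s \<in> K"
    and e_in_K: "e \<in> K"
    and ee [simp]: "e * e = e"
    and eJ [simp]: "e * J a = J a"
    and Je [simp]: "J a * e = J a"
    and J_left: "J a * a * e = e"
    and J_right: "e * a * J a = e"
    and J_regular: "w \<in> K \<Longrightarrow> w * J w * w = w"

text \<open>Simplicity gives x and y in e S e with x a y = e. Then \<open>e * a * y * x\<close> and
  \<open>y * x * a * e\<close> are idempotents below \<open>e\<close>, hence equal to
  \<open>e\<close> by primitivity, and \<open>y * x\<close> is the inverse of
  \<open>e * a * e\<close>.\<close>

lemma completely_simple_cs_kernel:
  assumes "sg_ideal K" "completely_simple K"
  shows "\<exists>e J. cs_kernel K e J"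
proof -
  have left: "s * k \<in> K" and right: "k * s \<in> K" if "k \<in> K" for s k
    using assms(1) that unfolding sg_ideal_def by blast+
  from assms(2) obtain e where e: "e \<in> K" "e * e = e"
    and prim: "\<And>f. f \<in> K \<Longrightarrow> f * f = f \<Longrightarrow> f = e * f \<Longrightarrow> f = f * e \<Longrightarrow> f = e"
    unfolding completely_simple_def idempotent_def by blast
  have simple: "\<exists>x y. w = x * a * y" if "a \<in> K" "w \<in> K" for a w
  proof -
    define I where "I = {x * a * y | x y. x \<in> K \<and> y \<in> K}"
    have mem: "x * a * y \<in> I" if "x \<in> K" "y \<in> K" for x y
      using that unfolding I_def by blast
    have "ideal_of K I" unfolding ideal_of_def
    proof (intro conjI ballI)
      show "I \<noteq> {}" using mem[OF e(1) e(1)] by blast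
      show "I \<subseteq> K" unfolding I_def using left right by blast
      fix s k assume "s \<in> K" "k \<in> I"
      then obtain x y where k: "k = x * a * y" "x \<in> K" "y \<in> K" unfolding I_def by blast
      show "s * k \<in> I" using mem[of "s * x" y] k left by (simp add: mult.assoc)
      show "k * s \<in> I" using mem[of x "y * s"] k right by (simp add: mult.assoc)
    qed
    then have "I = K" using assms(2) unfolding completely_simple_def by blast
    with that show ?thesis unfolding I_def by blast
  qed
  have ee: "e * (e * x) = e * x" for x using e(2) by (metis mult.assoc)
  have "\<exists>b. e * b = b \<and> b * e = b \<and> b * a * e = e \<and> e * a * b = e" for a
  proof -
    obtain x0 y0 where xy0: "e = x0 * (e * a * e) * y0"
      using simple[of "e * a * e" e] e(1) left right by blast
    define x y where "x = e * x0 * e" and "y = e * y0 * e"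
    have xy: "x * a * y = e"
    proof -
      have "x * a * y = e * (x0 * (e * a * e) * y0) * e"
        unfolding x_def y_def by (simp add: mult.assoc)
      also have "\<dots> = e" using xy0 e(2) by simp
      finally show ?thesis .
    qed
    have xe: "e * x = x" "x * e = x" "e * y = y" "y * e = y"
      unfolding x_def y_def using e(2) ee by (simp_all add: mult.assoc)
    have K: "x \<in> K" "y \<in> K" unfolding x_def y_def using left right e(1) by auto
    have "e * a * y * x = e"
    proof (rule prim)
      show "e * a * y * x \<in> K" using K left by simp
      have "e * a * y * x * (e * a * y * x) = e * a * y * ((x * e) * a * y) * x"
        by (simp add: mult.assoc)
      also have "\<dots> = e * a * y * x" using xy xe by (simp add: mult.assoc)
      finally show "e * a * y * x * (e * a * y * x) = e * a * y * x" .
    qed (use xe ee in \<open>simp_all add: mult.assoc\<close>)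
    moreover have "y * x * a * e = e"
    proof (rule prim)
      show "y * x * a * e \<in> K" using e left by simp
      have "y * x * a * e * (y * x * a * e) = y * (x * a * (e * y)) * x * a * e"
        by (simp add: mult.assoc)
      also have "\<dots> = y * x * a * e" using xy xe by (simp add: mult.assoc)
      finally show "y * x * a * e * (y * x * a * e) = y * x * a * e" .
      show "y * x * a * e = e * (y * x * a * e)" using xe by (metis mult.assoc)
    qed (use e in \<open>simp_all add: mult.assoc\<close>)
    ultimately show ?thesis using xe by (intro exI[of _ "y * x"]) (metis mult.assoc)
  qed
  then obtain J where J: "e * J a = J a" "J a * e = J a" "J a * a * e = e" "e * a * J a = e" for a
    by metis
  have "w * J w * w = w" if w: "w \<in> K" for w
  proof -
    \<comment> \<open>With w = x e y, the element e w e is the product of e x e and e y e. So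
      \<open>J w\<close> equals \<open>J y * J x\<close>, and the inner factors of
      \<open>w * J w * w\<close> cancel.\<close>
    obtain x y where xy: "w = x * e * y" using simple[OF e(1) w] by blast
    have "J w = J w * e * (e * x * J x)" using J e(2) by (simp add: mult.assoc)
    also have "\<dots> = J w * (x * (e * J x))" using J by (metis mult.assoc)
    also have "\<dots> = J w * (x * ((e * y * J y) * J x))" by (simp only: J)
    also have "\<dots> = J w * (x * e * y) * (e * (J y * J x))" using J(1) by (metis mult.assoc)
    also have "\<dots> = (J w * w * e) * (J y * J x)" by (simp add: xy mult.assoc)
    also have "\<dots> = J y * J x" using J by (metis mult.assoc)
    finally have "w * J w * w = x * (e * y * J y) * (J x * x * e) * y"
      by (simp add: xy mult.assoc)
    also have "\<dots> = w" unfolding J xy by (simp add: ee mult.assoc)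
    finally show ?thesis .
  qed
  with left right e J have "cs_kernel K e J" by unfold_locales auto
  then show ?thesis by blast
qed

context cs_kernel
begin

text \<open>Cancellation rules for right-associated words: \<open>e\<close> is absorbed next to
  \<open>J\<close>, and \<open>J a * a\<close> or \<open>a * J a\<close> disappears next to
  \<open>e\<close> or another value of \<open>J\<close>. Most have a second version with an
  arbitrary tail.\<close>

lemma e_simps [simp]:
  "e * (e * x) = e * x" "e * (J a * x) = J a * x" "J a * (e * x) = J a * x"
  "J a * (a * e) = e" "J a * (a * (e * x)) = e * x"
  "e * (a * J a) = e" "e * (a * (J a * x)) = e * x"
  "J a * (a * J b) = J b" "J a * (a * (J b * x)) = J b * x"
  "J b * (a * J a) = J b" "J b * (a * (J a * x)) = J b * x"
  by (metis ee eJ Je J_left J_right mult.assoc)+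

lemma J_regular_simps:
  "w \<in> K \<Longrightarrow> w * (J w * w) = w" "w \<in> K \<Longrightarrow> w * (J w * (w * x)) = w * x"
  using J_regular by (metis mult.assoc)+

lemma J_unique:
  assumes "x * e = x" "x * a * e = e" shows "x = J a"
proof -
  have "x = x * e * (a * J a)" using assms(1) J_right by (metis mult.assoc)
  also have "\<dots> = x * a * e * J a" using assms(1) by (simp add: mult.assoc)
  finally show ?thesis using assms by simp
qed

lemma J_conj_e [simp]: "J (e * a) = J a" "J (a * e) = J a"
  by (rule J_unique[symmetric]; simp add: mult.assoc)+

lemma J_mult_e: "J (a * (e * b)) = J b * J a"
proof (rule J_unique[symmetric])
  show "J b * J a * (a * (e * b)) * e = e" by (simp add: mult.assoc)
qed (simp add: mult.assoc)

text \<open>The group e S e, described through its fixed points.\<close>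

definition H where "H = {a. e * a = a \<and> a * e = a}"

lemma H_iff: "a \<in> H \<longleftrightarrow> e * a = a \<and> a * e = a" by (simp add: H_def)

lemma H_subset_K: "H \<subseteq> K"
proof
  fix a assume "a \<in> H"
  then show "a \<in> K" using K_right[OF e_in_K, of a] by (simp add: H_iff)
qed

lemma J_in_H [simp]: "J a \<in> H" by (simp add: H_iff)

abbreviation G where "G \<equiv> sub_group_monoid H e"

lemma G_simps [simp]: "carrier G = H" "\<one>\<^bsub>G\<^esub> = e" "x \<otimes>\<^bsub>G\<^esub> y = x * y"
  by (simp_all add: sub_group_monoid_def)

lemma group_G: "group G"
proof (rule groupI)
  show "\<exists>y\<in>carrier G. y \<otimes>\<^bsub>G\<^esub> x = \<one>\<^bsub>G\<^esub>" if "x \<in> carrier G" for x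
    using that J_left[of x] by (intro bexI[of _ "J x"]) (auto simp: H_iff mult.assoc)
qed (auto simp: H_iff mult.assoc[symmetric], simp add: mult.assoc)

sublocale G: group G by (rule group_G)

lemma inv_G [simp]: "a \<in> H \<Longrightarrow> inv\<^bsub>G\<^esub> a = J a"
  using J_left[of a] by (intro G.inv_equality) (auto simp: H_iff mult.assoc)

text \<open>The element \<open>a * J a\<close> is the idempotent in the R-class of \<open>a\<close>
  and the L-class of \<open>e\<close>, so it names the R-class. Thus \<open>rK\<close> is Green's
  relation R on \<open>K\<close>, extended by equality; \<open>lK\<close> is its dual.\<close>

definition rK where "rK = {(a, b). a = b \<or> a \<in> K \<and> b \<in> K \<and> a * J a = b * J b}"
definition lK where "lK = {(a, b). a = b \<or> a \<in> K \<and> b \<in> K \<and> J a * a = J b * b}"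

text \<open>Insert \<open>k = k * J k * k\<close> on the left; the remaining
  \<open>e * (k * c) * J (k * c)\<close> collapses to \<open>e\<close>. Consequently the R-class of
  a product is fixed by an initial segment with value in \<open>K\<close>.\<close>

lemma iota_mult: "k \<in> K \<Longrightarrow> k * c * J (k * c) = k * J k"
proof -
  assume k: "k \<in> K"
  have "k * c * J (k * c) = k * J k * (e * (k * c) * J (k * c))"
    using J_regular_simps(2)[OF k] by (simp add: mult.assoc)
  then show ?thesis unfolding J_right by (simp add: mult.assoc)
qed

lemma kappa_mult: "k \<in> K \<Longrightarrow> J (c * k) * (c * k) = J k * k"
proof -
  assume k: "k \<in> K"
  have "J (c * k) * (c * k) = (J (c * k) * (c * k) * e) * J k * k"
    using J_regular_simps(1)[OF k] by (simp add: mult.assoc)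
  then show ?thesis unfolding J_left by simp
qed

lemma rK_absorb: "k \<in> K \<Longrightarrow> (k * c, k * d) \<in> rK"
  using iota_mult K_right by (simp add: rK_def)

lemma lK_absorb: "k \<in> K \<Longrightarrow> (c * k, d * k) \<in> lK"
  using kappa_mult K_left by (simp add: lK_def)

lemma sg_congruence_rK: "sg_congruence rK"
proof (rule sg_congruenceI)
  fix a b s assume ab: "(a, b) \<in> rK"
  show "(a * s, b * s) \<in> rK" using ab iota_mult K_right by (auto simp: rK_def)
  show "(s * a, s * b) \<in> rK"
  proof (cases "a = b")
    case False
    with ab have K: "a \<in> K" "b \<in> K" and eq: "a * J a = b * J b" by (auto simp: rK_def)
    \<comment> \<open>Regularity turns \<open>a\<close> into a right multiple of \<open>b\<close>,
      so \<open>s * a\<close> is a right multiple of \<open>s * b\<close> and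
      \<open>iota_mult\<close> applies.\<close>
    have "s * a = s * (b * J b) * a" using J_regular[OF K(1)] eq by (simp add: mult.assoc)
    then have "s * a = (s * b) * (J b * a)" by (simp add: mult.assoc)
    then show ?thesis using iota_mult[OF K_left[OF K(2)], of s "J b * a"] K_left K
      by (auto simp: rK_def)
  qed (auto simp: rK_def)
qed (auto simp: rK_def)

lemma sg_congruence_lK: "sg_congruence lK"
proof (rule sg_congruenceI)
  fix a b s assume ab: "(a, b) \<in> lK"
  show "(s * a, s * b) \<in> lK" using ab kappa_mult K_left by (auto simp: lK_def)
  show "(a * s, b * s) \<in> lK"
  proof (cases "a = b")
    case False
    with ab have K: "a \<in> K" "b \<in> K" and eq: "J a * a = J b * b" by (auto simp: lK_def)
    have "a * s = a * (J b * b) * s" using J_regular[OF K(1)] eq by (simp add: mult.assoc)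
    then have "a * s = (a * J b) * (b * s)" by (simp add: mult.assoc)
    then show ?thesis using kappa_mult[OF K_right[OF K(2)], of "a * J b" s] K_right K
      by (auto simp: lK_def)
  qed (auto simp: lK_def)
qed (auto simp: lK_def)

end

subsection \<open>Lower central series\<close>

context group
begin

text \<open>The conjugate of h by g is the commutator [g, h] times h, and [g, h] lies in the next
  term because h lies in the previous one. Normality and inclusion are therefore proved in one
  induction.\<close>

lemma lower_central_subgroup_normal:
  "lower_central G k \<lhd> G \<and> lower_central G (Suc k) \<subseteq> lower_central G k"
proof (induction k)
  case 0
  have "lower_central G (Suc 0) \<subseteq> carrier G"
    unfolding lower_central.simps by (rule generate_incl) auto
  then show ?case by (simp add: normal_self)
next
  case (Suc k)
  let ?L = "lower_central G"
  have sub: "?L k \<subseteq> carrier G" using Suc normal_imp_subgroup subgroup.subset by blast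
  have comm: "g \<otimes> h \<otimes> inv g \<otimes> inv h \<in> ?L (Suc k)" if "g \<in> carrier G" "h \<in> ?L k" for g h
    unfolding lower_central.simps using that by (auto intro: generate.incl)
  have subgroup: "subgroup (?L (Suc k)) G"
    unfolding lower_central.simps using sub by (intro generate_is_subgroup) auto
  have normal: "?L (Suc k) \<lhd> G"
  proof (rule normal_invI[OF subgroup])
    fix g h assume g: "g \<in> carrier G" and h: "h \<in> ?L (Suc k)"
    have hk: "h \<in> ?L k" using h Suc by blast
    then have hc: "h \<in> carrier G" using sub by blast
    have "g \<otimes> h \<otimes> inv g \<otimes> inv h \<otimes> h \<in> ?L (Suc k)"
      using comm[OF g hk] h subgroup.m_closed[OF subgroup] by blast
    then show "g \<otimes> h \<otimes> inv g \<in> ?L (Suc k)" using g hc by (simp add: m_assoc)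
  qed
  interpret N: normal "?L (Suc k)" G by (rule normal)
  have "?L (Suc (Suc k)) \<subseteq> ?L (Suc k)"
    unfolding lower_central.simps(2)[of G "Suc k"]
    using N.inv_op_closed2 N.m_inv_closed N.m_closed
    by (intro generate_subgroup_incl[OF _ subgroup]) (auto simp del: lower_central.simps)
  with normal show ?case by blast
qed

lemmas lower_central_normal = lower_central_subgroup_normal[THEN conjunct1]
  and lower_central_decreasing = lower_central_subgroup_normal[THEN conjunct2]

lemma lower_central_commutator:
  assumes "g \<in> carrier G" "h \<in> lower_central G k"
  shows "g \<otimes> h \<otimes> inv g \<otimes> inv h \<in> lower_central G (Suc k)"
  unfolding lower_central.simps using assms by (auto intro: generate.incl)

lemma lower_central_commutator':
  assumes g: "g \<in> carrier G" and h: "h \<in> lower_central G k"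
  shows "h \<otimes> g \<otimes> inv h \<otimes> inv g \<in> lower_central G (Suc k)"
proof -
  have "h \<in> carrier G"
    using h lower_central_normal normal_imp_subgroup subgroup.subset by blast
  then have "h \<otimes> g \<otimes> inv h \<otimes> inv g = inv (g \<otimes> h \<otimes> inv g \<otimes> inv h)"
    using g by (simp add: inv_mult_group m_assoc)
  then show ?thesis 
    using subgroup.m_inv_closed[OF normal_imp_subgroup[OF lower_central_normal]
      lower_central_commutator[OF g h]] by (simp del: lower_central.simps)
qed

lemma exp_of_derived_normal: "(derived G ^^ k) (carrier G) \<lhd> G"
  by (induction k) (auto intro: normal_self derived_is_normal)

text \<open>Write u' = n u with n in \<open>N\<close>. The conjugates of c by u' and by u differ by
  the commutator of n with an element of \<open>M\<close>, which lies in \<open>L\<close>. The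
  expression is the one that \<open>q_mult\<close> produces for a product.\<close>

lemma conj_coset_eq:
  assumes L: "L \<lhd> G" and M: "M \<lhd> G"
    and NM: "\<And>n m. n \<in> N \<Longrightarrow> m \<in> M \<Longrightarrow> n \<otimes> m \<otimes> inv n \<otimes> inv m \<in> L"
    and u: "u \<in> carrier G" "u' \<in> carrier G" "u' \<otimes> inv u \<in> N"
    and c: "c \<in> M" "c' \<in> M" "L #> c = L #> c'"
    and a: "a \<in> carrier G" "a' \<in> carrier G" "L #> a = L #> a'"
  shows "L #> (u \<otimes> c \<otimes> inv u \<otimes> a) = L #> (u' \<otimes> c' \<otimes> inv u' \<otimes> a')"
proof -
  interpret L: normal L G by (rule L)
  interpret M: normal M G by (rule M)
  note [simp] = M.mem_carrier[OF c(1)] M.mem_carrier[OF c(2)] u(1,2) a(1,2)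
  define n where "n = u' \<otimes> inv u"
  define m where "m = u \<otimes> c \<otimes> inv u"
  have m: "m \<in> M" unfolding m_def by (simp add: M.inv_op_closed2 c)
  have n: "n \<in> carrier G" "n \<in> N" unfolding n_def using u(3) by auto
  have mc: "m \<in> carrier G" using m M.mem_carrier by blast
  have "u' \<otimes> c \<otimes> inv u' = (n \<otimes> m \<otimes> inv n \<otimes> inv m) \<otimes> m"
    using mc by (simp add: n(1) m_assoc)
      (simp add: n_def m_def m_assoc inv_mult_group inv_solve_left, simp add: m_assoc[symmetric])
  then have "L #> (u' \<otimes> c \<otimes> inv u') = L #> m"
    using NM[OF n(2) m] mc repr_independence[OF _ mc L.is_subgroup] by (simp add: rcosI L.subset)
  moreover have rcos: "L #> (x \<otimes> y) = (L #> x) <#> (L #> y)"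
    if "x \<in> carrier G" "y \<in> carrier G" for x y
    using L.rcos_sum that by simp
  ultimately have "L #> (u \<otimes> c \<otimes> inv u \<otimes> a) = L #> (u' \<otimes> c \<otimes> inv u' \<otimes> a')"
    unfolding m_def[symmetric] using mc a(3) by (simp add: rcos[of _ a] rcos[of _ a'])
  also have "\<dots> = L #> (u' \<otimes> c' \<otimes> inv u' \<otimes> a')"
    using c(3) by (simp add: rcos)
  finally show ?thesis .
qed

end

context cs_kernel
begin

subsection \<open>Descending from the kernel to the \<open>\<H>\<close>-classes\<close>

text \<open>The part of \<open>rees K\<close> that left translations carry into \<delta>, as
  \<open>central_step_left_translate\<close> requires of its upper congruence. Iterating it climbs a
  central chain.\<close>

definition shift_left where "shift_left \<delta> = {(a, b) \<in> rees K. \<forall>s. (s * a, s * b) \<in> \<delta>}"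
definition shift_right where "shift_right \<delta> = {(a, b) \<in> rees K. \<forall>s. (a * s, b * s) \<in> \<delta>}"

lemma shift_left_iff: "(a, b) \<in> shift_left \<delta> \<longleftrightarrow> (a, b) \<in> rees K \<and> (\<forall>s. (s * a, s * b) \<in> \<delta>)"
  by (simp add: shift_left_def)

lemma shift_right_iff: "(a, b) \<in> shift_right \<delta> \<longleftrightarrow> (a, b) \<in> rees K \<and> (\<forall>s. (a * s, b * s) \<in> \<delta>)"
  by (simp add: shift_right_def)

lemma sg_congruence_rees_K: "sg_congruence (rees K)"
  by (rule sg_congruence_rees) (auto intro: K_left K_right)

lemma sg_congruence_shift_left:
  assumes "sg_congruence \<delta>" shows "sg_congruence (shift_left \<delta>)"
proof (rule sg_congruenceI)
  note D = sg_congruenceD[OF assms] sg_congruenceD[OF sg_congruence_rees_K]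
  fix a b c s
  show "(a, a) \<in> shift_left \<delta>" using D(1,7) by (simp add: shift_left_iff)
  assume ab: "(a, b) \<in> shift_left \<delta>"
  then have ab': "(a, b) \<in> rees K" "\<And>s. (s * a, s * b) \<in> \<delta>" by (auto simp: shift_left_iff)
  show "(b, a) \<in> shift_left \<delta>" using ab' D(2,8) by (simp add: shift_left_iff)
  show "(s * a, s * b) \<in> shift_left \<delta>"
    using ab'(2)[of "_ * s"] D(11)[OF ab'(1)] by (simp add: shift_left_iff mult.assoc)
  show "(a * s, b * s) \<in> shift_left \<delta>"
    using D(6)[OF ab'(2)] D(12)[OF ab'(1)] by (simp add: shift_left_iff mult.assoc)
  assume "(b, c) \<in> shift_left \<delta>"
  then have bc': "(b, c) \<in> rees K" "\<And>s. (s * b, s * c) \<in> \<delta>" by (auto simp: shift_left_iff)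
  show "(a, c) \<in> shift_left \<delta>"
    using D(9)[OF ab'(1) bc'(1)] D(3)[OF ab'(2) bc'(2)] by (simp add: shift_left_iff)
qed

lemma sg_congruence_shift_right:
  assumes "sg_congruence \<delta>" shows "sg_congruence (shift_right \<delta>)"
proof (rule sg_congruenceI)
  note D = sg_congruenceD[OF assms] sg_congruenceD[OF sg_congruence_rees_K]
  fix a b c s
  show "(a, a) \<in> shift_right \<delta>" using D(1,7) by (simp add: shift_right_iff)
  assume ab: "(a, b) \<in> shift_right \<delta>"
  then have ab': "(a, b) \<in> rees K" "\<And>s. (a * s, b * s) \<in> \<delta>" by (auto simp: shift_right_iff)
  show "(b, a) \<in> shift_right \<delta>" using ab' D(2,8) by (simp add: shift_right_iff)
  show "(s * a, s * b) \<in> shift_right \<delta>"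
    using D(5)[OF ab'(2)] D(11)[OF ab'(1)] by (simp add: shift_right_iff mult.assoc)
  show "(a * s, b * s) \<in> shift_right \<delta>"
    using ab'(2)[of "s * _"] D(12)[OF ab'(1)] by (simp add: shift_right_iff mult.assoc)
  assume "(b, c) \<in> shift_right \<delta>"
  then have bc': "(b, c) \<in> rees K" "\<And>s. (b * s, c * s) \<in> \<delta>" by (auto simp: shift_right_iff)
  show "(a, c) \<in> shift_right \<delta>"
    using D(9)[OF ab'(1) bc'(1)] D(3)[OF ab'(2) bc'(2)] by (simp add: shift_right_iff)
qed

text \<open>After m + 1 shifts of \<open>rK\<close> the chain contains the Rees congruence of
  S^(m+1): for w in S^(m+1), hence in \<open>K\<close>, the products \<open>w * a\<close> and
  \<open>w * b\<close> share the R-class of w. From there the central steps lead down to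
  \<open>rK\<close>.\<close>

lemma all_pows_below_rK:
  assumes "sg_power (Suc m) \<subseteq> K" shows "all_pows_below rK"
proof -
  have cong: "sg_congruence ((shift_left ^^ k) rK)" for k
    by (induction k) (auto intro: sg_congruence_rK sg_congruence_shift_left)
  have absorb: "(w * c, w * d) \<in> (shift_left ^^ k) rK" if "w \<in> K" for w c d k
    using that
  proof (induction k arbitrary: w)
    case (Suc k)
    then show ?case using Suc.IH[OF K_left] K_right
      by (auto simp: shift_left_iff rees_def mult.assoc)
  qed (simp add: rK_absorb)
  have down: "all_pows_below rK" if "all_pows_below ((shift_left ^^ k) rK)" for k
    using that
  proof (induction k)
    case (Suc k)
    have "central_step ((shift_left ^^ Suc k) rK) ((shift_left ^^ k) rK)"
      by (rule central_step_left_translate[OF cong cong, where K = K])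
        (auto simp: absorb, auto simp: shift_left_iff rees_def)
    with Suc show ?case using all_pows_below_step by blast
  qed simp
  have up: "(a, b) \<in> (shift_left ^^ Suc k) rK"
    if "(a, b) \<in> rees K" "\<And>w. w \<in> sg_power (Suc k) \<Longrightarrow> (w * a, w * b) \<in> rK" for a b k
    using that
  proof (induction k arbitrary: a b)
    case (Suc k)
    have "(s * a, s * b) \<in> (shift_left ^^ Suc k) rK" for s
    proof (rule Suc.IH)
      show "(s * a, s * b) \<in> rees K" using Suc.prems(1) sg_congruenceD(5)[OF sg_congruence_rees_K] by blast
      show "(w * (s * a), w * (s * b)) \<in> rK" if "w \<in> sg_power (Suc k)" for w
        using Suc.prems(2)[OF sg_power_mult_right[OF that, of s]] by (simp add: mult.assoc)
    qed
    then show ?case using Suc.prems(1) by (simp add: shift_left_iff)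
  qed (simp add: shift_left_iff)
  have "rees (sg_power (Suc m)) \<subseteq> (shift_left ^^ Suc m) rK"
  proof (rule subrelI, rule up)
    fix a b assume "(a, b) \<in> rees (sg_power (Suc m) :: 'a set)"
    then show "(a, b) \<in> rees K" using assms by (auto simp: rees_def)
  qed (use assms rK_absorb in blast)
  then show ?thesis using down all_pows_below_rees_power all_pows_below_mono by blast
qed

lemma all_pows_below_lK:
  assumes "sg_power (Suc m) \<subseteq> K" shows "all_pows_below lK"
proof -
  have cong: "sg_congruence ((shift_right ^^ k) lK)" for k
    by (induction k) (auto intro: sg_congruence_lK sg_congruence_shift_right)
  have absorb: "(c * w, d * w) \<in> (shift_right ^^ k) lK" if "w \<in> K" for w c d k
    using that
  proof (induction k arbitrary: w)
    case (Suc k)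
    then show ?case using Suc.IH[OF K_right] K_left
      by (auto simp: shift_right_iff rees_def mult.assoc)
  qed (simp add: lK_absorb)
  have down: "all_pows_below lK" if "all_pows_below ((shift_right ^^ k) lK)" for k
    using that
  proof (induction k)
    case (Suc k)
    have "central_step ((shift_right ^^ Suc k) lK) ((shift_right ^^ k) lK)"
      by (rule central_step_right_translate[OF cong cong, where K = K])
        (auto simp: absorb, auto simp: shift_right_iff rees_def)
    with Suc show ?case using all_pows_below_step by blast
  qed simp
  have up: "(a, b) \<in> (shift_right ^^ Suc k) lK"
    if "(a, b) \<in> rees K" "\<And>w. w \<in> sg_power (Suc k) \<Longrightarrow> (a * w, b * w) \<in> lK" for a b k
    using that
  proof (induction k arbitrary: a b)
    case (Suc k)
    have "(a * s, b * s) \<in> (shift_right ^^ Suc k) lK" for s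
    proof (rule Suc.IH)
      show "(a * s, b * s) \<in> rees K" using Suc.prems(1) sg_congruenceD(6)[OF sg_congruence_rees_K] by blast
      show "(a * s * w, b * s * w) \<in> lK" if "w \<in> sg_power (Suc k)" for w
        using Suc.prems(2)[OF sg_power_mult_left[OF that, of s]] by (simp add: mult.assoc)
    qed
    then show ?case using Suc.prems(1) by (simp add: shift_right_iff)
  qed (simp add: shift_right_iff)
  have "rees (sg_power (Suc m)) \<subseteq> (shift_right ^^ Suc m) lK"
  proof (rule subrelI, rule up)
    fix a b assume "(a, b) \<in> rees (sg_power (Suc m) :: 'a set)"
    then show "(a, b) \<in> rees K" using assms by (auto simp: rees_def)
  qed (use assms lK_absorb in blast)
  then show ?thesis using down all_pows_below_rees_power all_pows_below_mono by blast
qed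

end

context cs_kernel
begin

subsection \<open>Congruences inside the \<open>\<H>\<close>-classes\<close>

text \<open>The quotient of the group coordinates \<open>(e b e) (e a e)\<^sup>-\<^sup>1\<close>.\<close>

definition q where "q a b = e * b * J a"

lemma q_in_H [simp]: "q a b \<in> H" by (simp add: q_def H_iff mult.assoc)

lemma q_refl: "q a a = e" by (simp add: q_def mult.assoc)

lemma q_trans: "q a c = q b c * q a b" by (simp add: q_def mult.assoc)

lemma q_inv: "q b a = J (q a b)"
proof -
  have "J (q a b) = J (e * b * (e * J a))" by (simp add: q_def mult.assoc)
  also have "\<dots> = J (J a) * J b" using J_mult_e[of "e * b" "J a"] by simp
  also have "J (J a) = e * a * e"
    by (rule J_unique[symmetric]) (simp_all add: mult.assoc)
  finally show ?thesis by (simp add: q_def mult.assoc)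
qed

text \<open>The passage from \<open>a * c\<close> to \<open>b * d\<close> goes through
  \<open>b * c\<close>. Replacing \<open>a\<close> by \<open>b\<close> contributes
  \<open>q a b\<close> because they share their L-class; replacing \<open>c\<close> by
  \<open>d\<close>, which share their R-class, contributes a conjugate of
  \<open>q c d\<close>.\<close>

lemma q_mult:
  assumes "(a, b) \<in> lK" "(c, d) \<in> rK"
  defines "u \<equiv> e * b * c * J c"
  shows "q (a * c) (b * d) = u * q c d * J u * q a b"
proof -
  have "e * b * d * e = e * b * (d * J d) * (e * d * e)" by (simp add: mult.assoc)
  also have "d * J d = c * J c" using assms(2) by (auto simp: rK_def)
  finally have bd: "e * b * d * e = u * (e * d * e)" by (simp add: u_def mult.assoc)
  have "J (b * c) = J (u * (e * c))"
  proof -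
    have "u * (e * c) * e = e * (b * c) * e" by (simp add: u_def mult.assoc)
    then show ?thesis using J_conj_e by metis
  qed
  then have J_bc: "J (b * c) = J c * J u" by (simp add: J_mult_e)
  have "q (b * c) (b * d) = (e * b * d * e) * J (b * c)" by (simp add: q_def mult.assoc)
  also have "\<dots> = u * q c d * J u" unfolding bd J_bc by (simp add: q_def mult.assoc)
  finally have 1: "q (b * c) (b * d) = u * q c d * J u" .
  have "e * b = (e * b * e) * (J b * b)" by (simp add: mult.assoc)
  also have "J b * b = J a * a" using assms(1) by (auto simp: lK_def)
  finally have "e * b = q a b * (e * a)" by (simp add: q_def mult.assoc)
  then have "q (a * c) (b * c) = q a b * (e * (a * c) * J (a * c))"
    by (simp add: q_def mult.assoc[symmetric])
  then have "q (a * c) (b * c) = q a b" unfolding J_right by (simp add: q_def mult.assoc)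
  with 1 show ?thesis using q_trans[of "a * c" "b * d" "b * c"] by simp
qed

text \<open>The congruence inside the H-classes that belongs to a normal subgroup \<open>L\<close>
  of \<open>G\<close>; it interpolates between equality and all of
  \<open>rK \<inter> lK\<close>.\<close>

definition theta where "theta L = {(a, b) \<in> rK \<inter> lK. q a b \<in> L}"

lemma thetaD: "(a, b) \<in> theta L \<Longrightarrow> (a, b) \<in> rK \<and> (a, b) \<in> lK \<and> q a b \<in> L"
  by (simp add: theta_def)

lemma sg_congruence_theta:
  assumes "L \<lhd> G" shows "sg_congruence (theta L)"
proof -
  interpret L: normal L G by (rule assms)
  note R = sg_congruenceD[OF sg_congruence_rK] and L = sg_congruenceD[OF sg_congruence_lK]
  have e: "e \<in> L" using L.one_closed by simp
  show ?thesis
  proof (rule sg_congruenceI)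
    fix a b c s
    show "(a, a) \<in> theta L" using R(1) L(1) e by (simp add: theta_def q_refl)
    assume "(a, b) \<in> theta L"
    note ab = this[THEN thetaD]
    show "(b, a) \<in> theta L"
      using ab R(2) L(2) L.m_inv_closed[of "q a b"] by (simp add: theta_def q_inv[of b a])
    have "q (s * a) (s * b) \<in> L"
    proof -
      define u where "u = e * s * a * J a"
      have "u \<in> H" by (simp add: u_def H_iff mult.assoc)
      then have "u * q a b * J u \<in> L" using L.inv_op_closed2[of u "q a b"] ab by simp
      then show ?thesis
        using q_mult[OF L(1)[of s], of a b] ab by (simp add: u_def q_refl mult.assoc)
    qed
    then show "(s * a, s * b) \<in> theta L" using ab R(5) L(5) by (simp add: theta_def)
    have "q (a * s) (b * s) = q a b"
    proof -
      define u where "u = e * b * s * J s"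
      have "q (a * s) (b * s) = u * e * J u * q a b"
        unfolding u_def using q_mult[of a b s s] ab R(1)[of s] by (simp add: q_refl)
      also have "u * e * J u = e" by (simp add: u_def mult.assoc[symmetric] J_right)
          (use J_right[of "b * s * J s"] in \<open>simp add: mult.assoc\<close>)
      finally show ?thesis by (simp add: q_def mult.assoc)
    qed
    then show "(a * s, b * s) \<in> theta L" using ab R(6) L(6) by (simp add: theta_def)
    assume "(b, c) \<in> theta L"
    note bc = this[THEN thetaD]
    show "(a, c) \<in> theta L"
      using ab bc R(3) L(3) L.m_closed[of "q b c" "q a b"] by (auto simp: theta_def q_trans[of a c b])
  qed
qed

text \<open>An element of \<open>K\<close> is the product of its three Rees coordinates, and all
  three agree here.\<close>

lemma theta_trivial: "theta {e} \<subseteq> Id"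
proof (rule subrelI)
  fix a b assume "(a, b) \<in> theta {e}"
  then have ab: "(a, b) \<in> rK" "(a, b) \<in> lK" "q a b = e" by (auto simp: theta_def)
  show "(a, b) \<in> Id"
  proof (cases "a = b")
    case False
    then have K: "a \<in> K" "b \<in> K" and i: "a * J a = b * J b" and k: "J a * a = J b * b"
      using ab by (auto simp: rK_def lK_def)
    have "e * b * e = q a b * (e * a * e)" by (simp add: q_def mult.assoc)
    then have g: "e * b * e = e * a * e" using ab(3) by (simp add: mult.assoc)
    have coord: "w = (w * J w) * (e * w * e) * (J w * w)" if "w \<in> K" for w
      using that by (simp add: mult.assoc J_regular_simps)
    show ?thesis using coord[OF K(1)] coord[OF K(2)] i k g by simp
  qed simp
qed

text \<open>For a product, \<open>q_mult\<close> expresses the quotient along each row with its own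
  conjugator. The two conjugators differ by an element of \<open>N\<close>, so
  \<open>conj_coset_eq\<close> applies. The nilpotent case takes \<open>N = H\<close>, the solvable
  case \<open>N = M\<close>.\<close>

lemma cmat_theta_coset:
  assumes L: "L \<lhd> G" and M: "M \<lhd> G" and \<alpha>: "sg_congruence \<alpha>"
    and NM: "\<And>n m. n \<in> N \<Longrightarrow> m \<in> M \<Longrightarrow> n * m * J n * J m \<in> L" and NH: "N \<subseteq> H"
    and \<alpha>N: "\<And>a a' c c'. (a, a') \<in> \<alpha> \<Longrightarrow> (c, c') \<in> \<alpha> \<Longrightarrow> q (a * c * J c) (a' * c' * J c') \<in> N"
    and mat: "cmat \<alpha> (theta M) a b c d"
  shows "L #>\<^bsub>G\<^esub> q a b = L #>\<^bsub>G\<^esub> q c d"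
  using mat
proof induction
  case (cmat_mult a b c d a' b' c' d')
  have MH: "M \<subseteq> H" using M normal_imp_subgroup subgroup.subset by fastforce
  have rows: "(a, b) \<in> theta M" "(c, d) \<in> theta M" "(a', b') \<in> theta M" "(c', d') \<in> theta M"
    using cmat_rows[OF _ sg_congruence_theta[OF M]] cmat_mult(1,2) by blast+
  have cols: "(b, d) \<in> \<alpha>" "(a', c') \<in> \<alpha>"
    using cmat_columns[OF _ \<alpha>] cmat_mult(1,2) by blast+
  define u u' where "u = e * b * a' * J a'" and "u' = e * d * c' * J c'"
  have H: "u \<in> H" "u' \<in> H" by (simp_all add: u_def u'_def H_iff mult.assoc)
  have "u' * J u = q (b * a' * J a') (d * c' * J c')"
  proof -
    have "J u = J (b * a' * J a')" unfolding u_def using J_conj_e(1) by (metis mult.assoc)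
    then show ?thesis by (simp add: q_def u'_def mult.assoc)
  qed
  then have uN: "u' * J u \<in> N" using \<alpha>N[OF cols] by simp
  have "L #>\<^bsub>G\<^esub> (u \<otimes>\<^bsub>G\<^esub> q a' b' \<otimes>\<^bsub>G\<^esub> inv\<^bsub>G\<^esub> u \<otimes>\<^bsub>G\<^esub> q a b) =
      L #>\<^bsub>G\<^esub> (u' \<otimes>\<^bsub>G\<^esub> q c' d' \<otimes>\<^bsub>G\<^esub> inv\<^bsub>G\<^esub> u' \<otimes>\<^bsub>G\<^esub> q c d)"
    by (rule G.conj_coset_eq[OF L M, where N = N])
      (use NM NH MH H uN rows[THEN thetaD] cmat_mult(3,4) in \<open>auto simp: subset_iff\<close>)
  then show ?case
    using q_mult[of a b a' b'] q_mult[of c d c' d'] rows[THEN thetaD] H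
    by (simp add: u_def u'_def)
qed (simp_all add: q_refl)

lemma TC_theta:
  assumes L: "L \<lhd> G" and M: "M \<lhd> G" and \<alpha>: "sg_congruence \<alpha>"
    and NM: "\<And>n m. n \<in> N \<Longrightarrow> m \<in> M \<Longrightarrow> n * m * J n * J m \<in> L" and NH: "N \<subseteq> H"
    and \<alpha>N: "\<And>a a' c c'. (a, a') \<in> \<alpha> \<Longrightarrow> (c, c') \<in> \<alpha> \<Longrightarrow> q (a * c * J c) (a' * c' * J c') \<in> N"
  shows "TC_holds [\<alpha>, theta M] (theta L)" and "TC_holds [theta M, \<alpha>] (theta L)"
proof -
  interpret L: normal L G by (rule L)
  have coset: "L #>\<^bsub>G\<^esub> q a b = L #>\<^bsub>G\<^esub> q c d" if "cmat \<alpha> (theta M) a b c d" for a b c d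
    using L M \<alpha> NM NH \<alpha>N that by (rule cmat_theta_coset)
  note cM = sg_congruence_theta[OF M]
  have mem: "x \<in> L \<longleftrightarrow> L #>\<^bsub>G\<^esub> x = L" if "x \<in> H" for x
    using G.coset_join1[OF _ _ L.is_subgroup] G.coset_join2[OF _ L.is_subgroup] that by auto
  show "TC_holds [\<alpha>, theta M] (theta L)"
    unfolding TC_holds_binary_iff
  proof (intro allI impI)
    fix a b c d assume m: "cmat \<alpha> (theta M) a b c d" and ab: "(a, b) \<in> theta L"
    have "q c d \<in> L" using coset[OF m] ab[THEN thetaD] mem by simp
    then show "(c, d) \<in> theta L"
      using thetaD[OF cmat_rows[OF m cM, THEN conjunct2]] unfolding theta_def by blast
  qed
  show "TC_holds [theta M, \<alpha>] (theta L)"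
    unfolding TC_holds_binary_iff
  proof (intro allI impI)
    fix a b c d assume m: "cmat (theta M) \<alpha> a b c d" and "(a, b) \<in> theta L"
    note ab = this(2)[THEN thetaD]
    have ac: "(a, c) \<in> theta M" and bd: "(b, d) \<in> theta M" using cmat_columns[OF m cM] by auto
    have cd: "(c, d) \<in> rK" "(c, d) \<in> lK"
      using sg_congruence_square[OF sg_congruence_rK, of a c b d]
        sg_congruence_square[OF sg_congruence_lK, of a c b d]
        ac[THEN thetaD] bd[THEN thetaD] ab by blast+
    have eq: "L #>\<^bsub>G\<^esub> q a c = L #>\<^bsub>G\<^esub> q b d" using coset[OF cmat_transpose[OF m]] .
    have "q a c \<in> L #>\<^bsub>G\<^esub> q b d"
      unfolding eq[symmetric] by (rule G.rcos_self) (auto intro: L.is_subgroup)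
    then obtain l where l: "l \<in> L" "q a c = l * q b d" unfolding r_coset_def by auto
    have lH: "l \<in> H" using l(1) L.subset by auto
    \<comment> \<open>The way around the square from c through a and b to d; modulo \<open>L\<close>
      the first and last quotients are inverse to each other, which leaves a conjugate of
      \<open>q a b\<close>.\<close>
    have "q c d = q b d * q a b * q c a" using q_trans[of c d a] q_trans[of a d b] by simp
    also have "q c a = J (q b d) * J l"
      unfolding q_inv[of c a] l(2) using J_mult_e[of l "q b d"] q_in_H[of b d] by (simp add: H_iff)
    finally have "q c d = (q b d * q a b * J (q b d)) * J l" by (simp add: mult.assoc)
    moreover have "q b d * q a b * J (q b d) \<in> L"
      using L.inv_op_closed2[of "q b d" "q a b"] ab by simp
    moreover have "J l \<in> L" using L.m_inv_closed[OF l(1)] lH by simp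
    ultimately have "q c d \<in> L" using L.m_closed[of _ "J l"] by simp
    then show "(c, d) \<in> theta L" using cd by (simp add: theta_def)
  qed
qed

section \<open>Sufficiency for solvability and for left and right nilpotence\<close>

lemma all_pows_below_theta_H:
  assumes "nilpotent_extension K" shows "all_pows_below (theta H)"
proof -
  obtain m where "m \<ge> 1" "sg_power m \<subseteq> K" using assms unfolding nilpotent_extension_def by blast
  then obtain k where "sg_power (Suc k) \<subseteq> K" by (cases m) auto
  then have "all_pows_below (rK \<inter> lK)"
    using all_pows_below_rK all_pows_below_lK all_pows_below_Int by blast
  moreover have "theta H = rK \<inter> lK" by (auto simp: theta_def)
  ultimately show ?thesis by simp
qed

lemma derived_pow_trivial:
  assumes "nilpotent_extension K" "solvable G"
  shows "\<exists>d. (derived_pow d :: 'a rel) = Id"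
proof -
  let ?D = "\<lambda>k. (derived G ^^ k) H"
  have norm: "?D k \<lhd> G" for k using G.exp_of_derived_normal[of k] by simp
  have "\<exists>d. derived_pow d \<subseteq> theta (?D k)" for k
  proof (induction k)
    case 0
    then show ?case using all_pows_below_theta_H[OF assms(1)] unfolding all_pows_below_def by simp
  next
    case (Suc k)
    then obtain d where d: "derived_pow d \<subseteq> theta (?D k)" by blast
    have DH: "?D k \<subseteq> H" using G.exp_of_derived_in_carrier[of H k] by simp
    have "TC_holds [theta (?D k), theta (?D k)] (theta (?D (Suc k)))"
    proof (rule TC_theta(1)[OF norm norm sg_congruence_theta[OF norm] _ DH])
      fix n m assume nm: "n \<in> ?D k" "m \<in> ?D k"
      then have "n \<otimes>\<^bsub>G\<^esub> m \<otimes>\<^bsub>G\<^esub> inv\<^bsub>G\<^esub> n \<otimes>\<^bsub>G\<^esub> inv\<^bsub>G\<^esub> m \<in> ?D (Suc k)"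
        unfolding funpow.simps o_apply derived_def by (intro generate.incl) blast
      then show "n * m * J n * J m \<in> ?D (Suc k)"
        using nm[THEN subsetD[OF DH]] by simp
    next
      fix a a' c c' assume "(a, a') \<in> theta (?D k)" "(c, c') \<in> theta (?D k)"
      \<comment> \<open>Since \<open>c\<close> and \<open>c'\<close> are R-related,
        \<open>c * J c\<close> does not change; only the left factor moves, and right translation
        keeps it in its class.\<close>
      then have "(a * (c * J c), a' * (c * J c)) \<in> theta (?D k)" "c * J c = c' * J c'"
        using sg_congruenceD(6)[OF sg_congruence_theta[OF norm]] by (auto dest!: thetaD simp: rK_def)
      then show "q (a * c * J c) (a' * c' * J c') \<in> ?D k" by (auto dest!: thetaD simp: mult.assoc)
    qed
    then show ?case
      using derived_pow_Suc_subset[OF sg_congruence_theta[OF norm] _ d] by blast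
  qed
  moreover obtain k where "?D k = {e}"
    using assms(2) G.solvable_iff_trivial_derived_seq by auto
  ultimately obtain d where "derived_pow d \<subseteq> theta {e}" by metis
  then show ?thesis
    using theta_trivial eq_Id_iff_subset[OF sg_congruence_derived_pow] by blast
qed

lemma nilpotent_pows_trivial:
  assumes "nilpotent_extension K" "nilpotent_group G"
  shows "\<exists>d. (left_pow (Suc d) :: 'a rel) = Id" "\<exists>d. (right_pow (Suc d) :: 'a rel) = Id"
proof -
  note norm = G.lower_central_normal
  have "all_pows_below (theta (lower_central G k))" for k
  proof (induction k)
    case 0
    then show ?case using all_pows_below_theta_H[OF assms(1)] by simp
  next
    case (Suc k)
    have LH: "lower_central G k \<subseteq> H"
      using norm[of k] normal_imp_subgroup subgroup.subset by fastforce
    have comm: "n * m * J n * J m \<in> lower_central G (Suc k)"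
      if "n \<in> H" "m \<in> lower_central G k" for n m
      using G.lower_central_commutator[of n m k] that subsetD[OF LH that(2)]
      by (simp del: lower_central.simps)
    note TC = TC_theta[OF norm[of "Suc k"] norm[of k] sg_congruence_UNIV, where N = H]
    have "central_step (theta (lower_central G k)) (theta (lower_central G (Suc k)))"
      unfolding central_step_def
      by (intro conjI TC sg_congruence_theta norm comm subset_refl q_in_H)
    with Suc.IH show ?case by (rule all_pows_below_step)
  qed
  moreover obtain k where "lower_central G k = {e}"
    using assms(2) unfolding nilpotent_group_def by auto
  ultimately have "all_pows_below (theta {e})" by metis
  then have "all_pows_below (Id :: 'a rel)" using theta_trivial all_pows_below_mono by blast
  then show "\<exists>d. (left_pow (Suc d) :: 'a rel) = Id" "\<exists>d. (right_pow (Suc d) :: 'a rel) = Id"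
    unfolding all_pows_below_def eq_Id_iff_subset[OF sg_congruence_left_pow]
      eq_Id_iff_subset[OF sg_congruence_right_pow] by simp_all
qed

end

subsection \<open>Cube groups\<close>

text \<open>Functions on the subsets of \<open>V\<close> generated by the \<open>g\<close>-valued indicators of the upper faces
  \<open>{X. A \<subseteq> X}\<close> with \<open>g \<in> N A\<close>. If \<open>[N A, N B] \<subseteq> N (A \<union> B)\<close>, then a discrete derivative
  in direction \<open>v\<close> again has this form, for \<open>A \<mapsto> N (insert v A)\<close>.\<close>

inductive_set cube :: "('a, 'b) monoid_scheme \<Rightarrow> 'i set \<Rightarrow> ('i set \<Rightarrow> 'a set) \<Rightarrow> ('i set \<Rightarrow> 'a) set"
  for G (structure) and V N where
  gen: "A \<subseteq> V \<Longrightarrow> g \<in> N A \<Longrightarrow> (\<lambda>X. if A \<subseteq> X then g else \<one>) \<in> cube G V N"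
| mult: "F \<in> cube G V N \<Longrightarrow> F' \<in> cube G V N \<Longrightarrow> (\<lambda>X. F X \<otimes> F' X) \<in> cube G V N"

context group
begin

definition commutator_family :: "('i set \<Rightarrow> 'a set) \<Rightarrow> bool" where
  "commutator_family N \<longleftrightarrow> (\<forall>A. subgroup (N A) G) \<and>
     (\<forall>A B. \<forall>g\<in>N A. \<forall>h\<in>N B. g \<otimes> h \<otimes> inv g \<otimes> inv h \<in> N (A \<union> B))"

lemma commutator_family_carrier: "commutator_family N \<Longrightarrow> g \<in> N A \<Longrightarrow> g \<in> carrier G"
  unfolding commutator_family_def using subgroup.subset by blast

lemma commutator_family_one: "commutator_family N \<Longrightarrow> \<one> \<in> N A"
  unfolding commutator_family_def using subgroup.one_closed by blast

lemma commutator_family_insert: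
  "commutator_family N \<Longrightarrow> commutator_family (\<lambda>A. N (insert v A))"
  unfolding commutator_family_def by (metis Un_insert_left Un_insert_right insert_absorb2)

lemma cube_closed:
  "F \<in> cube G V N \<Longrightarrow> commutator_family N \<Longrightarrow> F X \<in> carrier G"
  by (induction rule: cube.induct) (auto dest: commutator_family_carrier)

text \<open>Conjugating an indicator over B by one over A gives the indicator over
  \<open>A \<union> B\<close> of the commutator, times the indicator over B. Two inductions extend
  this to products.\<close>

lemma cube_conj:
  assumes N: "commutator_family N" and F: "F \<in> cube G V N"
    and F': "F' \<in> cube G V (\<lambda>A. N (insert v A))"
  shows "(\<lambda>X. F X \<otimes> F' X \<otimes> inv (F X)) \<in> cube G V (\<lambda>A. N (insert v A))"
  using F F'
proof (induction arbitrary: F' rule: cube.induct)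
  case (gen A g)
  have g: "g \<in> carrier G" using gen N commutator_family_carrier by blast
  from gen(3) show ?case
  proof (induction rule: cube.induct)
    case (gen B h)
    have h: "h \<in> carrier G" using gen N commutator_family_carrier by blast
    have c: "g \<otimes> h \<otimes> inv g \<otimes> inv h \<in> N (insert v (A \<union> B))"
      using N \<open>g \<in> N A\<close> gen(2) unfolding commutator_family_def by fastforce
    have "(\<lambda>X. (if A \<union> B \<subseteq> X then g \<otimes> h \<otimes> inv g \<otimes> inv h else \<one>) \<otimes> (if B \<subseteq> X then h else \<one>))
      \<in> cube G V (\<lambda>A. N (insert v A))"
      using gen \<open>A \<subseteq> V\<close> c by (intro cube.mult cube.gen) auto
    also have "(\<lambda>X. (if A \<union> B \<subseteq> X then g \<otimes> h \<otimes> inv g \<otimes> inv h else \<one>) \<otimes> (if B \<subseteq> X then h else \<one>)) =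
      (\<lambda>X. (if A \<subseteq> X then g else \<one>) \<otimes> (if B \<subseteq> X then h else \<one>) \<otimes> inv (if A \<subseteq> X then g else \<one>))"
      using g h by (intro ext) (auto simp: m_assoc)
    finally show ?case .
  next
    case (mult F1 F2)
    have "F1 X \<in> carrier G" "F2 X \<in> carrier G" for X
      using mult cube_closed commutator_family_insert[OF N] by blast+
    then have "(\<lambda>X. (if A \<subseteq> X then g else \<one>) \<otimes> (F1 X \<otimes> F2 X) \<otimes> inv (if A \<subseteq> X then g else \<one>)) =
      (\<lambda>X. ((if A \<subseteq> X then g else \<one>) \<otimes> F1 X \<otimes> inv (if A \<subseteq> X then g else \<one>)) \<otimes>
        ((if A \<subseteq> X then g else \<one>) \<otimes> F2 X \<otimes> inv (if A \<subseteq> X then g else \<one>)))"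
      using g by (intro ext) (auto simp: m_assoc inv_solve_left)
    then show ?case using cube.mult[OF mult(3,4)] by simp
  qed
next
  case (mult F1 F2)
  have "F1 X \<in> carrier G" "F2 X \<in> carrier G" "F' X \<in> carrier G" for X
    using mult cube_closed commutator_family_insert[OF N] N by blast+
  then have "(\<lambda>X. F1 X \<otimes> F2 X \<otimes> F' X \<otimes> inv (F1 X \<otimes> F2 X)) =
    (\<lambda>X. F1 X \<otimes> (F2 X \<otimes> F' X \<otimes> inv (F2 X)) \<otimes> inv (F1 X))"
    by (intro ext) (simp add: m_assoc inv_mult_group)
  then show ?case using mult(3)[OF mult(4)[OF mult(5)]] by simp
qed

text \<open>An indicator over A survives on the lower face if v is not in A, and in the derivative
  if it is. The derivative of a product is the derivative of \<open>F1\<close> times a conjugate of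
  that of \<open>F2\<close>, which is where \<open>cube_conj\<close> enters.\<close>

lemma cube_derivative:
  assumes N: "commutator_family N" and F: "F \<in> cube G (insert v W) N" and v: "v \<notin> W"
  shows "(\<lambda>X. F (X - {v})) \<in> cube G W N \<and>
    (\<lambda>X. F (insert v X) \<otimes> inv (F (X - {v}))) \<in> cube G W (\<lambda>A. N (insert v A))"
  using F
proof (induction rule: cube.induct)
  case (gen A g)
  have g: "g \<in> carrier G" using gen N commutator_family_carrier by blast
  note one = commutator_family_one[OF N]
  show ?case
  proof (cases "v \<in> A")
    case True
    have "(\<lambda>X. if A \<subseteq> X - {v} then g else \<one>) = (\<lambda>X. if {} \<subseteq> X then \<one> else \<one>)"
      using True by (auto simp: fun_eq_iff)
    moreover have "(\<lambda>X. (if A \<subseteq> insert v X then g else \<one>) \<otimes> inv (if A \<subseteq> X - {v} then g else \<one>)) =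
      (\<lambda>X. if A - {v} \<subseteq> X then g else \<one>)"
      using True g by (intro ext) (auto split: if_splits)
    moreover have "insert v (A - {v}) = A" using True by blast
    ultimately show ?thesis
      using cube.gen[of "{}" W \<one> N G] cube.gen[of "A - {v}" W g "\<lambda>A. N (insert v A)" G] gen one
      by auto
  next
    case False
    have "(\<lambda>X. if A \<subseteq> X - {v} then g else \<one>) = (\<lambda>X. if A \<subseteq> X then g else \<one>)"
      using False by (auto simp: fun_eq_iff subset_Diff_insert)
    moreover have "(\<lambda>X. (if A \<subseteq> insert v X then g else \<one>) \<otimes> inv (if A \<subseteq> X - {v} then g else \<one>)) =
      (\<lambda>X. if {} \<subseteq> X then \<one> else \<one>)"
      using False g by (intro ext) (auto split: if_splits)
    moreover have "A \<subseteq> W" using False gen(1) by blast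
    ultimately show ?thesis
      using cube.gen[of "{}" W \<one> "\<lambda>A. N (insert v A)" G] cube.gen[of A W g N G] gen(2) one
      by auto
  qed
next
  case (mult F1 F2)
  have "F1 X \<in> carrier G" "F2 X \<in> carrier G" for X using mult cube_closed N by blast+
  then have "(\<lambda>X. F1 (insert v X) \<otimes> F2 (insert v X) \<otimes> inv (F1 (X - {v}) \<otimes> F2 (X - {v}))) =
    (\<lambda>X. (F1 (insert v X) \<otimes> inv (F1 (X - {v}))) \<otimes>
      (F1 (X - {v}) \<otimes> (F2 (insert v X) \<otimes> inv (F2 (X - {v}))) \<otimes> inv (F1 (X - {v}))))"
    by (intro ext) (simp add: m_assoc inv_mult_group inv_solve_left)
  then show ?case
    using cube_conj[OF N mult(3)[THEN conjunct1] mult(4)[THEN conjunct2]] mult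
    by (simp add: cube.mult)
qed

text \<open>Differentiate once in every direction. Each derivative adds its direction to the index
  of \<open>N\<close>, and it keeps the top value because the function is trivial elsewhere.\<close>

lemma cube_top:
  assumes "finite V" "commutator_family N" "F \<in> cube G V N" "\<And>X. X \<subset> V \<Longrightarrow> F X = \<one>"
  shows "F V \<in> N V"
  using assms
proof (induction V arbitrary: F N rule: finite_induct)
  case empty
  have sub: "subgroup (N {}) G" using empty(1) unfolding commutator_family_def by blast
  from empty(2) show ?case
    by (induction rule: cube.induct) (auto intro: subgroup.m_closed[OF sub])
next
  case (insert v W)
  define F1 where "F1 = (\<lambda>X. F (insert v X) \<otimes> inv (F (X - {v})))"
  have F1: "F1 \<in> cube G W (\<lambda>A. N (insert v A))"
    using cube_derivative[OF insert.prems(1,2) insert.hyps(2)] unfolding F1_def by blast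
  have "F1 W \<in> N (insert v W)"
  proof (rule insert.IH[OF commutator_family_insert[OF insert.prems(1)] F1])
    fix X assume X: "X \<subset> W"
    then have "insert v X \<subset> insert v W" "X - {v} \<subset> insert v W"
      using insert.hyps(2) by auto
    then show "F1 X = \<one>" unfolding F1_def using insert.prems(3) by simp
  qed
  moreover have "W - {v} = W" "W \<subset> insert v W" using insert.hyps by blast+
  then have "F1 W = F (insert v W)"
    unfolding F1_def using insert.prems(3)[of W] cube_closed[OF insert.prems(2,1)] by simp
  ultimately show ?case by simp
qed

lemma cube_if_depends:
  assumes "finite A" "A \<union> B \<subseteq> V" "\<And>X. \<phi> X \<in> carrier G" "\<And>X. \<phi> X = \<phi> (X \<inter> A)"
    "\<And>C. C \<subseteq> A \<Longrightarrow> N (B \<union> C) = carrier G"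
  shows "(\<lambda>X. if B \<subseteq> X then \<phi> X else \<one>) \<in> cube G V N"
  using assms
proof (induction A arbitrary: B \<phi> rule: finite_induct)
  case empty
  define g where "g = \<phi> {}"
  have eq: "\<phi> X = g" for X using empty.prems(3)[of X] by (simp add: g_def)
  show ?case
    unfolding eq using empty.prems(1) empty.prems(2)[of "{}"] empty.prems(4)[of "{}"]
    by (intro cube.gen) (auto simp: g_def)
next
  case (insert v A)
  define \<psi> where "\<psi> X = \<phi> (insert v X) \<otimes> inv (\<phi> (X - {v}))" for X
  have eqs: "insert v (X \<inter> A) = insert v X \<inter> insert v A" "(X \<inter> A) - {v} = (X - {v}) \<inter> insert v A"
    for X by auto
  have dep: "\<phi> (insert v X) = \<phi> (insert v (X \<inter> A))" "\<phi> (X - {v}) = \<phi> ((X \<inter> A) - {v})" for X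
    unfolding eqs using insert.prems(3) by blast+
  have "(\<lambda>X. if insert v B \<subseteq> X then \<psi> X else \<one>) \<in> cube G V N"
  proof (rule insert.IH)
    show "\<psi> X = \<psi> (X \<inter> A)" for X unfolding \<psi>_def using dep by metis
    show "N (insert v B \<union> C) = carrier G" if "C \<subseteq> A" for C
      using insert.prems(4)[of "insert v C"] that by (simp add: subset_insertI2)
  qed (use insert.prems \<psi>_def in auto)
  moreover have "(\<lambda>X. if B \<subseteq> X then \<phi> (X - {v}) else \<one>) \<in> cube G V N"
  proof (rule insert.IH)
    show "\<phi> (X - {v}) = \<phi> (X \<inter> A - {v})" for X by (rule dep)
    show "N (B \<union> C) = carrier G" if "C \<subseteq> A" for C using insert.prems(4)[of C] that by blast
  qed (use insert.prems in auto)
  moreover have "(\<lambda>X. if B \<subseteq> X then \<phi> X else \<one>) =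
    (\<lambda>X. (if insert v B \<subseteq> X then \<psi> X else \<one>) \<otimes> (if B \<subseteq> X then \<phi> (X - {v}) else \<one>))"
    using insert.prems(2) by (intro ext) (auto simp: \<psi>_def m_assoc insert_absorb)
  ultimately show ?case by (simp add: cube.mult)
qed

text \<open>The exponential weights make \<open>[\<gamma>\<^sub>i, \<gamma>\<^sub>j] \<subseteq> \<gamma>\<^bsub>max i j + 1\<^esub>\<close> sufficient for the commutator condition,
  which avoids the sharper \<open>[\<gamma>\<^sub>i, \<gamma>\<^sub>j] \<subseteq> \<gamma>\<^bsub>i + j\<^esub>\<close>.\<close>

definition central_family :: "nat \<Rightarrow> 'i set \<Rightarrow> 'a set" where
  "central_family r A = {g \<in> carrier G. \<forall>w. r * 2 ^ w < card A \<longrightarrow> g \<in> lower_central G (Suc w)}"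

text \<open>If \<open>A \<union> B\<close> has more than r 2^(w+1) elements, then A or B has more
  than r 2^w. So one of g and h lies one term of the series before the one required, and the
  commutator makes up for it.\<close>

lemma commutator_family_central: "commutator_family (central_family r)"
  unfolding commutator_family_def
proof (intro conjI allI ballI)
  fix A :: "'i set"
  have sub: "subgroup (lower_central G k) G" for k
    using lower_central_normal normal_imp_subgroup by blast
  show "subgroup (central_family r A) G"
    by (rule subgroupI)
      (auto simp: central_family_def simp del: lower_central.simps
        intro: subgroup.one_closed[OF sub] subgroup.m_closed[OF sub] subgroup.m_inv_closed[OF sub])
next
  fix A B :: "'i set" and g h
  assume g: "g \<in> central_family r A" and h: "h \<in> central_family r B"
  have c: "g \<in> carrier G" "h \<in> carrier G" using g h by (auto simp: central_family_def)
  have "g \<otimes> h \<otimes> inv g \<otimes> inv h \<in> lower_central G (Suc w)" if w: "r * 2 ^ w < card (A \<union> B)" for w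
  proof -
    have AB: "card (A \<union> B) \<le> card A + card B" by (rule card_Un_le)
    have "g \<in> lower_central G w \<or> h \<in> lower_central G w"
    proof (cases w)
      case (Suc w')
      then have "r * 2 ^ w' < card A \<or> r * 2 ^ w' < card B" using w AB by auto
      then show ?thesis using g h Suc by (auto simp: central_family_def simp del: lower_central.simps)
    qed (use c in simp)
    then show ?thesis using lower_central_commutator lower_central_commutator' c by blast
  qed
  then show "g \<otimes> h \<otimes> inv g \<otimes> inv h \<in> central_family r (A \<union> B)"
    using c by (simp add: central_family_def del: lower_central.simps)
qed

lemma central_family_small: "card A \<le> r \<Longrightarrow> central_family r A = carrier G"
proof -
  assume "card A \<le> r"
  moreover have "r \<le> r * 2 ^ w" for w by simp
  ultimately have "\<not> r * 2 ^ w < card A" for w by (meson le_trans not_le)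
  then show ?thesis by (simp add: central_family_def)
qed

text \<open>The derivative in direction v is trivial below \<open>W\<close>, so
  \<open>cube_top\<close> places its value at \<open>W\<close> in the group attached to
  \<open>insert v W\<close>. That set is large enough to force the value into a trivial term of the
  lower central series.\<close>

lemma cube_central_term_condition:
  assumes c: "lower_central G c = {\<one>}" and W: "finite W" "v \<notin> W" "r * 2 ^ c \<le> card W"
    and F: "F \<in> cube G (insert v W) (central_family r)"
    and eq: "\<And>X. X \<subset> W \<Longrightarrow> F X = F (insert v X)"
  shows "F W = F (insert v W)"
proof -
  note fam = commutator_family_central[of r]
  define F1 where "F1 = (\<lambda>X. F (insert v X) \<otimes> inv (F (X - {v})))"
  have F1: "F1 \<in> cube G W (\<lambda>A. central_family r (insert v A))"
    using cube_derivative[OF fam F W(2)] unfolding F1_def by blast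
  have closed: "F X \<in> carrier G" for X using cube_closed[OF F fam] .
  have "F1 W \<in> central_family r (insert v W)"
  proof (rule cube_top[OF W(1) commutator_family_insert[OF fam] F1])
    fix X assume X: "X \<subset> W"
    then have "X - {v} = X" using W(2) by blast
    then show "F1 X = \<one>" unfolding F1_def using eq[OF X] closed by simp
  qed
  moreover have "r * 2 ^ c < card (insert v W)" using W by simp
  ultimately have "F1 W \<in> lower_central G (Suc c)"
    by (simp add: central_family_def del: lower_central.simps)
  then have "F1 W = \<one>" using lower_central_decreasing[of c] c by blast
  moreover have "W - {v} = W" using W(2) by blast
  ultimately have "F (insert v W) \<otimes> inv (F W) = \<one>" by (simp add: F1_def)
  then show ?thesis using closed inv_solve_right'[of \<one> "F (insert v W)" "F W"] by simp
qed

end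

subsection \<open>Supernilpotence of nilpotent extensions\<close>

text \<open>The value at \<open>[]\<close> is unspecified.\<close>

fun lprod :: "('a::semigroup_mult) list \<Rightarrow> 'a" where
  "lprod [a] = a"
| "lprod (a # b # xs) = a * lprod (b # xs)"

lemma lprod_Cons: "xs \<noteq> [] \<Longrightarrow> lprod (a # xs) = a * lprod xs"
  by (cases xs) auto

lemma lprod_append: "xs \<noteq> [] \<Longrightarrow> ys \<noteq> [] \<Longrightarrow> lprod (xs @ ys) = lprod xs * lprod ys"
  by (induction xs rule: lprod.induct) (auto simp: lprod_Cons mult.assoc)

lemma lprod_in_sg_power: "length xs = Suc k \<Longrightarrow> lprod xs \<in> sg_power (Suc k)"
proof (induction xs arbitrary: k rule: lprod.induct)
  case (2 a b xs)
  then obtain k' where k: "k = Suc k'" "length (b # xs) = Suc k'" by (cases k) auto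
  show ?case using sg_power_mult_left[OF "2.IH"[OF k(2)], of a] k(1) by simp
qed auto

definition literal :: "bool list \<Rightarrow> nat \<times> 'a \<times> 'a \<Rightarrow> 'a" where
  "literal x = (\<lambda>(i, a, b). if x ! i then b else a)"

lemma Mgen_word:
  assumes "f \<in> Mgen (replicate n UNIV)"
  shows "\<exists>ws. ws \<noteq> [] \<and> fst ` set ws \<subseteq> {..<n} \<and> f = (\<lambda>x. lprod (map (literal x) ws))"
  using assms
proof (induction rule: Mgen.induct)
  case (gen i a b)
  then show ?case by (intro exI[of _ "[(i, a, b)]"]) (auto simp: literal_def fun_eq_iff)
next
  case (mult f g)
  then obtain u v where "u \<noteq> []" "fst ` set u \<subseteq> {..<n}" "f = (\<lambda>x. lprod (map (literal x) u))"
    "v \<noteq> []" "fst ` set v \<subseteq> {..<n}" "g = (\<lambda>x. lprod (map (literal x) v))" by blast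
  then show ?case by (intro exI[of _ "u @ v"]) (auto simp: lprod_append)
qed

definition depends :: "nat set \<Rightarrow> (bool list \<Rightarrow> 'b) \<Rightarrow> bool" where
  "depends A \<phi> \<longleftrightarrow> (\<forall>x y. (\<forall>i\<in>A. x ! i = y ! i) \<longrightarrow> \<phi> x = \<phi> y)"

lemma depends_word: "depends (fst ` set ws) (\<lambda>x. h (lprod (map (literal x) ws)))"
  unfolding depends_def
proof (intro allI impI)
  fix x y :: "bool list" assume "\<forall>i\<in>fst ` set ws. x ! i = y ! i"
  then have "map (literal x) ws = map (literal y) ws" by (auto simp: literal_def)
  then show "h (lprod (map (literal x) ws)) = h (lprod (map (literal y) ws))" by (rule arg_cong)
qed

text \<open>Fewer than d coordinates miss some i < d, and flipping coordinate i moves the top vertex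
  to one covered by the hypothesis without changing \<phi>.\<close>

lemma depends_term_condition:
  assumes "depends A \<phi>" "finite A" "card A < d"
    and "\<And>x. length x = d \<Longrightarrow> x \<noteq> replicate d True \<Longrightarrow> \<phi> (x @ [False]) = \<phi> (x @ [True])"
  shows "\<phi> (replicate d True @ [False]) = \<phi> (replicate d True @ [True])"
proof -
  have "\<not> {..<d} \<subseteq> A" using card_mono[OF assms(2), of "{..<d}"] assms(3) by auto
  then obtain i where i: "i < d" "i \<notin> A" by blast
  define x where "x = (replicate d True)[i := False]"
  have x: "length x = d" "x \<noteq> replicate d True"
    using i by (auto simp: x_def list_eq_iff_nth_eq)
  have "\<phi> (replicate d True @ [b]) = \<phi> (x @ [b])" for b
  proof -
    have "\<forall>j\<in>A. (replicate d True @ [b]) ! j = (x @ [b]) ! j"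
      using i by (auto simp: x_def nth_append nth_list_update)
    then show ?thesis using assms(1) unfolding depends_def by blast
  qed
  then show ?thesis using assms(4)[OF x] by simp
qed

context cs_kernel
begin

text \<open>In a word with more than m + 1 factors, the first and the last m + 1 factors multiply
  into \<open>K\<close> and fix the R- and the L-coordinate, by \<open>iota_mult\<close> and
  \<open>kappa_mult\<close>. A shorter word involves at most m + 1 coordinates anyway.\<close>

lemma Mgen_coordinates_depend:
  assumes m: "sg_power (Suc m) \<subseteq> K" and f: "f \<in> Mgen (replicate n UNIV)"
  shows "(\<exists>A\<subseteq>{..<n}. card A \<le> Suc m \<and> depends A f) \<or> (\<forall>x. f x \<in> K)"
    and "\<exists>A\<subseteq>{..<n}. card A \<le> Suc m \<and> depends A (\<lambda>x. f x * J (f x))"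
    and "\<exists>A\<subseteq>{..<n}. card A \<le> Suc m \<and> depends A (\<lambda>x. J (f x) * f x)"
proof -
  obtain ws where ws: "ws \<noteq> []" "fst ` set ws \<subseteq> {..<n}" and f_eq: "f = (\<lambda>x. lprod (map (literal x) ws))"
    using Mgen_word[OF f] by blast
  have card: "card (fst ` set v) \<le> length v" for v :: "(nat \<times> 'a \<times> 'a) list"
    by (metis card_length length_map list.set_map)
  note dep = depends_word[of ws]
  have "((\<exists>A\<subseteq>{..<n}. card A \<le> Suc m \<and> depends A f) \<or> (\<forall>x. f x \<in> K)) \<and>
    (\<exists>A\<subseteq>{..<n}. card A \<le> Suc m \<and> depends A (\<lambda>x. f x * J (f x))) \<and>
    (\<exists>A\<subseteq>{..<n}. card A \<le> Suc m \<and> depends A (\<lambda>x. J (f x) * f x))"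
  proof (cases "length ws \<le> Suc m")
    case True
    then have "card (fst ` set ws) \<le> Suc m" using card[of ws] by simp
    then show ?thesis
      using ws(2) dep[of "\<lambda>a. a"] dep[of "\<lambda>a. a * J a"] dep[of "\<lambda>a. J a * a"]
      unfolding f_eq by blast
  next
    case False
    define u where "u = take (Suc m) ws"
    define u' where "u' = drop (Suc m) ws"
    define v where "v = drop (length ws - Suc m) ws"
    define v' where "v' = take (length ws - Suc m) ws"
    have ne: "u \<noteq> []" "u' \<noteq> []" "v \<noteq> []" "v' \<noteq> []" and len: "length u = Suc m" "length v = Suc m"
      using False ws(1) by (auto simp: u_def u'_def v_def v'_def)
    have split: "ws = u @ u'" "ws = v' @ v" by (simp_all add: u_def u'_def v_def v'_def)
    have fu: "f x = lprod (map (literal x) u) * lprod (map (literal x) u')" for x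
      unfolding f_eq split(1) using ne by (simp add: lprod_append)
    have fv: "f x = lprod (map (literal x) v') * lprod (map (literal x) v)" for x
      unfolding f_eq split(2) using ne by (simp add: lprod_append)
    have K: "lprod (map (literal x) u) \<in> K" "lprod (map (literal x) v) \<in> K" for x
      using lprod_in_sg_power[of "map (literal x) u" m] lprod_in_sg_power[of "map (literal x) v" m] len m
      by auto
    have sub: "fst ` set u \<subseteq> {..<n}" "fst ` set v \<subseteq> {..<n}"
      using ws(2) set_take_subset[of "Suc m" ws] set_drop_subset[of "length ws - Suc m" ws]
      unfolding u_def v_def by blast+
    have "f x \<in> K" for x unfolding fu using K K_right by blast
    moreover have "depends (fst ` set u) (\<lambda>x. f x * J (f x))"
      unfolding fu iota_mult[OF K(1)] by (rule depends_word)
    moreover have "depends (fst ` set v) (\<lambda>x. J (f x) * f x)"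
      unfolding fv kappa_mult[OF K(2)] by (rule depends_word)
    ultimately show ?thesis using sub card[of u] card[of v] len by metis
  qed
  then show "(\<exists>A\<subseteq>{..<n}. card A \<le> Suc m \<and> depends A f) \<or> (\<forall>x. f x \<in> K)"
    "\<exists>A\<subseteq>{..<n}. card A \<le> Suc m \<and> depends A (\<lambda>x. f x * J (f x))"
    "\<exists>A\<subseteq>{..<n}. card A \<le> Suc m \<and> depends A (\<lambda>x. J (f x) * f x)" by blast+
qed

text \<open>The cube groups index vertices by sets, the term condition by Boolean lists.\<close>

definition of_set :: "nat \<Rightarrow> nat set \<Rightarrow> bool list" where
  "of_set n X = map (\<lambda>i. i \<in> X) [0..<n]"

lemma cube_if_depends_list:
  assumes "depends A \<phi>" "A \<subseteq> {..<n}" "card A \<le> r" "\<And>x. \<phi> x \<in> H"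
  shows "(\<lambda>X. \<phi> (of_set n X)) \<in> cube G {..<n} (G.central_family r)"
proof -
  have fin: "finite A" using assms(2) finite_subset by blast
  have "(\<lambda>X. if {} \<subseteq> X then \<phi> (of_set n X) else \<one>\<^bsub>G\<^esub>) \<in> cube G {..<n} (G.central_family r)"
  proof (rule G.cube_if_depends[OF fin])
    show "\<phi> (of_set n X) = \<phi> (of_set n (X \<inter> A))" for X
    proof -
      have "\<forall>i\<in>A. of_set n X ! i = of_set n (X \<inter> A) ! i" using assms(2) by (auto simp: of_set_def)
      then show ?thesis using assms(1) unfolding depends_def by blast
    qed
    show "G.central_family r ({} \<union> C) = carrier G" if "C \<subseteq> A" for C
      using G.central_family_small[of C r] card_mono[OF fin that] assms(3) by simp
  qed (use assms in auto)
  then show ?thesis by simp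
qed

text \<open>The group coordinate of a product f g is that of f, times the sandwich entry
  \<open>J f * f * g * J g\<close>, times that of g. The entry depends on the L-coordinate of f and
  the R-coordinate of g only, hence the bound \<open>2 * Suc m\<close>.\<close>

lemma Mgen_group_coordinate_in_cube:
  assumes m: "sg_power (Suc m) \<subseteq> K" and f: "f \<in> Mgen (replicate n UNIV)"
  shows "(\<lambda>X. e * f (of_set n X) * e) \<in> cube G {..<n} (G.central_family (2 * Suc m))"
  using f
proof (induction rule: Mgen.induct)
  case (gen i a b)
  have "depends {i} (\<lambda>x. e * (if x ! i then b else a) * e)" by (auto simp: depends_def)
  then show ?case
    by (rule cube_if_depends_list) (use gen in \<open>auto simp: H_iff mult.assoc\<close>)
next
  case (mult f g)
  obtain A where A: "A \<subseteq> {..<n}" "card A \<le> Suc m" "depends A (\<lambda>x. J (f x) * f x)"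
    using Mgen_coordinates_depend(3)[OF m mult(1)] by blast
  obtain B where B: "B \<subseteq> {..<n}" "card B \<le> Suc m" "depends B (\<lambda>x. g x * J (g x))"
    using Mgen_coordinates_depend(2)[OF m mult(2)] by blast
  have "depends (A \<union> B) (\<lambda>x. (J (f x) * f x) * (g x * J (g x)))"
    using A(3) B(3) unfolding depends_def by (metis UnCI)
  then have "(\<lambda>X. (J (f (of_set n X)) * f (of_set n X)) * (g (of_set n X) * J (g (of_set n X))))
    \<in> cube G {..<n} (G.central_family (2 * Suc m))"
  proof (rule cube_if_depends_list)
    show "card (A \<union> B) \<le> 2 * Suc m" using card_Un_le[of A B] A(2) B(2) by simp
  qed (use A B in \<open>auto simp: H_iff mult.assoc\<close>)
  from cube.mult[OF cube.mult[OF mult(3) this] mult(4)] show ?case by (simp add: mult.assoc)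
qed

lemma supernilpotent_if_nilpotent_extension:
  assumes "nilpotent_extension K" "nilpotent_group G"
  shows "\<exists>d. (commutator (replicate (Suc d) UNIV) :: 'a rel) = Id"
proof -
  obtain m' where "m' \<ge> 1" "sg_power m' \<subseteq> K" using assms(1) unfolding nilpotent_extension_def by blast
  then obtain m where m: "sg_power (Suc m) \<subseteq> K" by (cases m') auto
  obtain c where c: "lower_central G c = {\<one>\<^bsub>G\<^esub>}" using assms(2) unfolding nilpotent_group_def by blast
  \<comment> \<open>The size that \<open>cube_central_term_condition\<close> asks for with
    \<open>r = 2 * Suc m\<close>; it also exceeds \<open>Suc m\<close>, as the other two coordinates
    need.\<close>
  define d where "d = 2 * Suc m * 2 ^ c"
  have "2 * Suc m * 1 \<le> 2 * Suc m * 2 ^ c" by (intro mult_le_mono2) simp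
  then have d: "Suc m < d" unfolding d_def by simp
  have "TC_holds (replicate (Suc d) (UNIV :: 'a rel)) Id"
    unfolding TC_holds_def
  proof (intro ballI impI)
    fix f :: "bool list \<Rightarrow> 'a"
    assume f: "f \<in> Mgen (replicate (Suc d) UNIV)"
    let ?top = "replicate d True"
    assume "\<forall>x. length x = length (replicate (Suc d) (UNIV :: 'a rel)) - 1 \<and>
      x \<noteq> replicate (length (replicate (Suc d) (UNIV :: 'a rel)) - 1) True \<longrightarrow>
      (f (x @ [False]), f (x @ [True])) \<in> Id"
    then have eq: "f (x @ [False]) = f (x @ [True])" if "length x = d" "x \<noteq> ?top" for x
      using that by simp
    have reduce: "\<phi> (?top @ [False]) = \<phi> (?top @ [True])"
      if A: "\<exists>A\<subseteq>{..<Suc d}. card A \<le> Suc m \<and> depends A \<phi>"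
        and \<phi>: "\<And>x y. f x = f y \<Longrightarrow> \<phi> x = \<phi> y" for \<phi> :: "bool list \<Rightarrow> 'a"
    proof -
      obtain A where A: "A \<subseteq> {..<Suc d}" "card A \<le> Suc m" "depends A \<phi>" using A by blast
      show ?thesis
      proof (rule depends_term_condition[OF A(3)])
        show "finite A" using A(1) finite_subset by blast
        show "card A < d" using A(2) d by simp
      qed (rule \<phi>[OF eq])
    qed
    note coords = Mgen_coordinates_depend[OF m f]
    \<comment> \<open>Rees coordinates determine elements of \<open>K\<close> only. A function with
      a value outside \<open>K\<close> depends on few coordinates as a whole.\<close>
    have "f (?top @ [False]) = f (?top @ [True])"
      using coords(1)
    proof
      assume "\<exists>A\<subseteq>{..<Suc d}. card A \<le> Suc m \<and> depends A f"
      then show ?thesis by (rule reduce)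
    next
      assume K: "\<forall>x. f x \<in> K"
      let ?a = "f (?top @ [False])" and ?b = "f (?top @ [True])"
      have i: "?a * J ?a = ?b * J ?b" by (rule reduce[OF coords(2)]) simp
      have k: "J ?a * ?a = J ?b * ?b" by (rule reduce[OF coords(3)]) simp
      define F where "F X = e * f (of_set (Suc d) X) * e" for X
      have of_set: "of_set (Suc d) X = of_set d X @ [False]"
        "of_set (Suc d) (insert d X) = of_set d X @ [True]" if "X \<subseteq> {..<d}" for X
        using that by (auto simp: of_set_def)
      have "F {..<d} = F (insert d {..<d})"
      proof (rule G.cube_central_term_condition[OF c])
        show "2 * Suc m * 2 ^ c \<le> card {..<d}" by (simp add: d_def)
        have "insert d {..<d} = {..<Suc d}" by auto
        then show "F \<in> cube G (insert d {..<d}) (G.central_family (2 * Suc m))"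
          using Mgen_group_coordinate_in_cube[OF m f] unfolding F_def by simp
        fix X assume X: "X \<subset> {..<d}"
        then obtain i where "i < d" "i \<notin> X" by auto
        then have "of_set d X ! i \<noteq> ?top ! i" by (simp add: of_set_def)
        then have "of_set d X \<noteq> ?top" by metis
        then show "F X = F (insert d X)"
          using eq[of "of_set d X"] of_set[of X] X by (simp add: F_def) (simp add: of_set_def)
      qed auto
      moreover have "of_set d {..<d} = ?top" by (auto simp: of_set_def list_eq_iff_nth_eq)
      ultimately have g: "e * ?a * e = e * ?b * e" using of_set[of "{..<d}"] by (simp add: F_def)
      then have "q ?a ?b = e"
        unfolding q_def using J_right[of ?a] by (metis eJ mult.assoc)
      then have "(?a, ?b) \<in> theta {e}" using i k K by (simp add: theta_def rK_def lK_def)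
      then show ?thesis using theta_trivial by blast
    qed
    then show "(f (replicate (length (replicate (Suc d) (UNIV :: 'a rel)) - 1) True @ [False]),
      f (replicate (length (replicate (Suc d) (UNIV :: 'a rel)) - 1) True @ [True])) \<in> Id" by simp
  qed
  moreover have "sg_congruence (Id :: 'a rel)" by (rule sg_congruenceI) auto
  ultimately have "commutator (replicate (Suc d) UNIV) \<subseteq> (Id :: 'a rel)"
    by (intro commutator_subset)
  then show ?thesis unfolding eq_Id_iff_subset[OF sg_congruence_commutator] by (rule exI)
qed

end

section \<open>The higher term condition for total congruences\<close>

lemma Mgen_replicate_mono:
  "f \<in> Mgen (replicate n UNIV) \<Longrightarrow> n \<le> n' \<Longrightarrow> f \<in> Mgen (replicate n' UNIV)"
proof (induction rule: Mgen.induct)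
  case (gen i a b)
  then show ?case using Mgen.gen[of i "replicate n' UNIV" a b] by simp
qed (auto intro: Mgen.mult)

lemma Mgen_replicate_gen: "i < n \<Longrightarrow> (\<lambda>x. if x ! i then b else a) \<in> Mgen (replicate n UNIV)"
  using Mgen.gen[of i "replicate n UNIV" a b] by simp

lemma supernilpotent_term_condition:
  fixes f :: "bool list \<Rightarrow> 'a::semigroup_mult"
  assumes "commutator (replicate (Suc d) UNIV) = (Id :: 'a rel)" "f \<in> Mgen (replicate (Suc d) UNIV)"
    and "\<And>x. length x = d \<Longrightarrow> x \<noteq> replicate d True \<Longrightarrow> f (x @ [False]) = f (x @ [True])"
  shows "f (replicate d True @ [False]) = f (replicate d True @ [True])"
proof -
  have "TC_holds (replicate (Suc d) (UNIV :: 'a rel)) Id"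
    using TC_holds_commutator[of "replicate (Suc d) (UNIV :: 'a rel)"] unfolding assms(1) .
  from this[unfolded TC_holds_def, rule_format, OF assms(2)] show ?thesis
    using assms(3) by simp
qed

subsection \<open>Necessity: nilpotent extension\<close>

context cs_kernel
begin

text \<open>For \<alpha> = \<open>Id\<close> this is the inclusion of
  \<open>sg_power (Suc k)\<close> in \<open>K\<close>; the property is followed along each series
  until the series reaches \<open>Id\<close>.\<close>

definition reaches_K :: "'a rel \<Rightarrow> nat \<Rightarrow> bool" where
  "reaches_K \<alpha> k \<longleftrightarrow> (\<forall>s \<in> sg_power (Suc k). \<exists>c\<in>K. (s, c) \<in> \<alpha>)"

lemma reaches_K_UNIV: "reaches_K UNIV 0"
  using e_in_K by (auto simp: reaches_K_def)

lemma reaches_K_bcomm: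
  assumes \<alpha>: "sg_congruence \<alpha>" "reaches_K \<alpha> k" and \<beta>: "sg_congruence \<beta>" "reaches_K \<beta> l"
  shows "reaches_K (bcomm \<alpha> \<beta>) (Suc k + l)"
  unfolding reaches_K_def
proof
  note cong = sg_congruence_commutator[of "[\<alpha>, \<beta>]"]
  fix s :: 'a assume "s \<in> sg_power (Suc (Suc k + l))"
  then have "s \<in> sg_power (Suc k + Suc l)" by simp
  then obtain a b where s: "s = a * b" "a \<in> sg_power (Suc k)" "b \<in> sg_power (Suc l)"
    using sg_power_split by blast
  obtain a' b' where a': "a' \<in> K" "(a, a') \<in> \<alpha>" and b': "b' \<in> K" "(b, b') \<in> \<beta>"
    using \<alpha>(2) \<beta>(2) s(2,3) unfolding reaches_K_def by blast
  \<comment> \<open>The inverse inside makes f a right identity of \<open>a'\<close> and a left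
    identity of \<open>b'\<close> at the same time. The first property makes the first row of the
    matrix below constant, the second relates \<open>f * b\<close> to \<open>b\<close>.\<close>
  define f where "f = b' * J (a' * b') * a'"
  have af: "a' * f = a'"
  proof -
    have "a' * f = (a' * b' * J (a' * b')) * a'" by (simp add: f_def mult.assoc)
    then show ?thesis unfolding iota_mult[OF a'(1)] using J_regular[OF a'(1)] by simp
  qed
  have fb: "f * b' = b'"
  proof -
    have "f * b' = b' * (J (a' * b') * (a' * b'))" by (simp add: f_def mult.assoc)
    then show ?thesis unfolding kappa_mult[OF b'(1)] using J_regular[OF b'(1)]
      by (simp add: mult.assoc)
  qed
  have "(f * b, f * b') \<in> \<beta>" using sg_congruenceD(5)[OF \<beta>(1) b'(2)] .
  then have fbb: "(f * b, b) \<in> \<beta>"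
    using fb sg_congruenceD(2)[OF \<beta>(1) b'(2)] sg_congruenceD(3)[OF \<beta>(1), of "f * b" b' b] by simp
  have "cmat \<alpha> \<beta> (a' * (f * b)) (a' * b) (a * (f * b)) (a * b)"
    by (rule cmat_mult[OF cmat1[OF sg_congruenceD(2)[OF \<alpha>(1) a'(2)]] cmat2[OF fbb]])
  moreover have "a' * (f * b) = a' * b" using af by (metis mult.assoc)
  ultimately have "(a * (f * b), a * b) \<in> bcomm \<alpha> \<beta>"
    using cmat_bcomm sg_congruenceD(1)[OF cong] by metis
  then have "(s, a * (f * b)) \<in> bcomm \<alpha> \<beta>" using sg_congruenceD(2)[OF cong] s(1) by blast
  moreover have "f \<in> K" unfolding f_def using a'(1) K_left by simp
  then have "a * (f * b) \<in> K" using K_left K_right by simp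
  ultimately show "\<exists>c\<in>K. (s, c) \<in> bcomm \<alpha> \<beta>" by blast
qed

lemma reaches_K_pows:
  "\<exists>k. reaches_K (derived_pow d) k" "\<exists>k. reaches_K (left_pow (Suc d)) k"
  "\<exists>k. reaches_K (right_pow (Suc d)) k"
proof -
  show "\<exists>k. reaches_K (derived_pow d) k"
  proof (induction d)
    case (Suc d)
    then show ?case
      using reaches_K_bcomm[OF sg_congruence_derived_pow _ sg_congruence_derived_pow]
      unfolding derived_pow.simps by blast
  qed (auto intro: reaches_K_UNIV)
  show "\<exists>k. reaches_K (left_pow (Suc d)) k"
  proof (induction d)
    case (Suc d)
    then show ?case
      using reaches_K_bcomm[OF sg_congruence_UNIV reaches_K_UNIV sg_congruence_left_pow]
      unfolding left_pow.simps by blast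
  qed (auto intro: reaches_K_UNIV)
  show "\<exists>k. reaches_K (right_pow (Suc d)) k"
  proof (induction d)
    case (Suc d)
    then show ?case
      using reaches_K_bcomm[OF sg_congruence_right_pow _ sg_congruence_UNIV reaches_K_UNIV]
      unfolding right_pow.simps by blast
  qed (auto intro: reaches_K_UNIV)
qed

lemma nilpotent_extension_if_reaches: "reaches_K Id k \<Longrightarrow> nilpotent_extension K"
  unfolding reaches_K_def nilpotent_extension_def by (intro exI[of _ "Suc k"]) auto

text \<open>Each factor \<open>s\<^sub>i\<close> is paired with \<open>h\<^sub>i\<^sub>-\<^sub>1 s\<^sub>i\<close>, where \<open>h\<^sub>i\<close> is a right identity of
  \<open>h\<^sub>i\<^sub>-\<^sub>1 s\<^sub>i\<close>. Once some coordinate is \<open>False\<close>, all later \<open>h\<^sub>i\<close> may be inserted freely.\<close>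

lemma absorbing_word:
  "s \<in> sg_power (Suc k) \<Longrightarrow>
    \<exists>g \<in> Mgen (replicate (Suc k) UNIV). \<exists>h\<in>K. depends {..k} g \<and>
      (\<forall>x. (\<forall>i\<le>k. x ! i) \<longrightarrow> g x = s) \<and> (\<forall>x. (\<exists>i\<le>k. \<not> x ! i) \<longrightarrow> g x * h = g x)"
proof (induction k arbitrary: s)
  case 0
  show ?case
    by (rule bexI[OF _ Mgen_replicate_gen[of 0 "Suc 0" s e]], rule bexI[OF _ e_in_K])
      (auto simp: depends_def)
next
  case (Suc k)
  from Suc.prems obtain s' t where s: "s = s' * t" "s' \<in> sg_power (Suc k)" by auto
  obtain g h where g: "g \<in> Mgen (replicate (Suc k) UNIV)" and h: "h \<in> K" and dep: "depends {..k} g"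
    and g1: "\<And>x. \<forall>i\<le>k. x ! i \<Longrightarrow> g x = s'" and g0: "\<And>x. \<exists>i\<le>k. \<not> x ! i \<Longrightarrow> g x * h = g x"
    using Suc.IH[OF s(2)] by blast
  define h' where "h' = J (h * t) * (h * t)"
  have h': "h' \<in> K" unfolding h'_def using h K_left K_right by blast
  have hth: "h * t * h' = h * t"
    using J_regular[of "h * t"] K_right[OF h] by (simp add: h'_def mult.assoc)
  define g' where "g' x = g x * (if x ! Suc k then t else h * t)" for x
  have "g' \<in> Mgen (replicate (Suc (Suc k)) UNIV)"
    unfolding g'_def using Mgen_replicate_mono[OF g, of "Suc (Suc k)"]
    by (intro Mgen.mult Mgen_replicate_gen) auto
  moreover have "depends {..Suc k} g'"
    unfolding depends_def
  proof (intro allI impI)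
    fix x y :: "bool list" assume xy: "\<forall>i\<in>{..Suc k}. x ! i = y ! i"
    then have "g x = g y" using dep unfolding depends_def by simp
    then show "g' x = g' y" using xy by (simp add: g'_def)
  qed
  moreover have "g' x = s" if "\<forall>i\<le>Suc k. x ! i" for x
    using g1[of x] that s(1) by (simp add: g'_def)
  moreover have "g' x * h' = g' x" if x: "\<exists>i\<le>Suc k. \<not> x ! i" for x
  proof -
    have "g' x = g x * (h * t)"
    proof (cases "x ! Suc k")
      case True
      then have "\<exists>i\<le>k. \<not> x ! i" using x by (metis le_SucE)
      from g0[OF this] show ?thesis using True by (simp add: g'_def mult.assoc[symmetric])
    qed (simp add: g'_def)
    then show ?thesis using hth by (simp add: mult.assoc)
  qed
  ultimately show ?case using h' by (intro bexI[of _ g'] bexI[of _ h'] conjI allI impI)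
qed

text \<open>The last factor t is paired with \<open>h * t\<close>. Away from the top vertex the
  absorbing word swallows h, so both values agree; the term condition then gives s = s' h t, which
  lies in \<open>K\<close>.\<close>

lemma nilpotent_extension_if_supernilpotent:
  assumes "commutator (replicate (Suc d) UNIV) = (Id :: 'a rel)"
  shows "nilpotent_extension K"
proof -
  have "sg_power (Suc d) \<subseteq> K"
  proof
    fix s :: 'a assume s: "s \<in> sg_power (Suc d)"
    show "s \<in> K"
    proof (cases d)
      case 0
      \<comment> \<open>With d = 0 the term condition has no premises and identifies all
        elements.\<close>
      have "e = s"
        using supernilpotent_term_condition[OF assms Mgen_replicate_gen[of 0 "Suc d" s e]] 0 by auto
      then show ?thesis using e_in_K by simp
    next
      case (Suc k)
      obtain s' t where st: "s = s' * t" "s' \<in> sg_power (Suc k)" using s Suc by auto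
      obtain g h where g: "g \<in> Mgen (replicate (Suc k) UNIV)" and h: "h \<in> K" and dep: "depends {..k} g"
        and g1: "\<And>x. \<forall>i\<le>k. x ! i \<Longrightarrow> g x = s'" and g0: "\<And>x. \<exists>i\<le>k. \<not> x ! i \<Longrightarrow> g x * h = g x"
        using absorbing_word[OF st(2)] by blast
      define f where "f x = g x * (if x ! d then t else h * t)" for x
      have f: "f \<in> Mgen (replicate (Suc d) UNIV)"
        unfolding f_def using Mgen_replicate_mono[OF g, of "Suc d"] Suc
        by (intro Mgen.mult Mgen_replicate_gen) auto
      have "f (replicate d True @ [False]) = f (replicate d True @ [True])"
      proof (rule supernilpotent_term_condition[OF assms f])
        fix x :: "bool list" assume len: "length x = d" and "x \<noteq> replicate d True"
        then obtain i where i: "i < d" "\<not> x ! i" by (auto simp: list_eq_iff_nth_eq)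
        have "g (x @ [False]) = g (x @ [True])"
          using dep len Suc unfolding depends_def by (simp add: nth_append)
        moreover have "\<exists>i\<le>k. \<not> (x @ [False]) ! i"
          using i len Suc by (intro exI[of _ i]) (auto simp: nth_append)
        then have "g (x @ [False]) * h = g (x @ [False])" by (rule g0)
        ultimately show "f (x @ [False]) = f (x @ [True])"
          using len by (simp add: f_def nth_append mult.assoc[symmetric])
      qed
      moreover have "g (replicate d True @ [b]) = s'" for b
      proof (intro g1 allI impI)
        fix i assume "i \<le> k"
        then have "i < d" using Suc by simp
        then show "(replicate d True @ [b]) ! i" by (simp add: nth_append)
      qed
      ultimately have "s = s' * (h * t)" using st(1) by (simp add: f_def nth_append)
      then show ?thesis using h K_left K_right by simp
    qed
  qed
  then show ?thesis unfolding nilpotent_extension_def by (intro exI[of _ "Suc d"]) simp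
qed

end

subsection \<open>Necessity: subgroups\<close>

locale sub_group_of =
  fixes H :: "('a::semigroup_mult) set" and e :: 'a
  assumes grp: "group (sub_group_monoid H e)"
begin

abbreviation P where "P \<equiv> sub_group_monoid H e"

sublocale P: group P by (rule grp)

lemma P_simps [simp]: "carrier P = H" "\<one>\<^bsub>P\<^esub> = e" "x \<otimes>\<^bsub>P\<^esub> y = x * y"
  by (simp_all add: sub_group_monoid_def)

lemma H_simps [simp]:
  "e \<in> H" "x \<in> H \<Longrightarrow> e * x = x" "x \<in> H \<Longrightarrow> x * e = x" "x \<in> H \<Longrightarrow> inv\<^bsub>P\<^esub> x \<in> H"
  "x \<in> H \<Longrightarrow> y \<in> H \<Longrightarrow> x * y \<in> H"
  "x \<in> H \<Longrightarrow> x * inv\<^bsub>P\<^esub> x = e" "x \<in> H \<Longrightarrow> inv\<^bsub>P\<^esub> x * x = e"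
  using P.one_closed P.l_one[of x] P.r_one[of x] P.inv_closed[of x] P.m_closed[of x y]
    P.r_inv[of x] P.l_inv[of x] by auto

definition class_of_one :: "'a rel \<Rightarrow> 'a set" where
  "class_of_one \<alpha> = {h \<in> H. (e, h) \<in> \<alpha>}"

lemma subgroup_class_of_one:
  assumes "sg_congruence \<alpha>" shows "subgroup (class_of_one \<alpha>) P"
proof (rule P.subgroupI)
  note D = sg_congruenceD[OF assms]
  show "class_of_one \<alpha> \<noteq> {}" using D(1)[of e] by (auto simp: class_of_one_def intro!: exI[of _ e])
  fix a assume "a \<in> class_of_one \<alpha>"
  then have a: "a \<in> H" "(e, a) \<in> \<alpha>" by (auto simp: class_of_one_def)
  have "(inv\<^bsub>P\<^esub> a, e) \<in> \<alpha>" using D(6)[OF a(2), of "inv\<^bsub>P\<^esub> a"] a(1) by simp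
  from D(2)[OF this] show "inv\<^bsub>P\<^esub> a \<in> class_of_one \<alpha>" using a(1) by (simp add: class_of_one_def)
  fix b assume "b \<in> class_of_one \<alpha>"
  then have b: "b \<in> H" "(e, b) \<in> \<alpha>" by (auto simp: class_of_one_def)
  show "a \<otimes>\<^bsub>P\<^esub> b \<in> class_of_one \<alpha>"
    using D(4)[OF a(2) b(2)] a(1) b(1) by (simp add: class_of_one_def)
qed (auto simp: class_of_one_def)

text \<open>Evaluating the commutator word on the pairs (e, g) and (e, h) gives a matrix with three
  entries e and the group commutator as the fourth. Two versions are stated because left and right
  powers put the two congruences in different orders.\<close>

lemma group_commutator_in_bcomm:
  assumes \<alpha>: "sg_congruence \<alpha>" and \<beta>: "sg_congruence \<beta>"
  shows "g \<in> class_of_one \<alpha> \<Longrightarrow> h \<in> class_of_one \<beta> \<Longrightarrow>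
      g * h * inv\<^bsub>P\<^esub> g * inv\<^bsub>P\<^esub> h \<in> class_of_one (bcomm \<alpha> \<beta>)"
    and "g \<in> class_of_one \<beta> \<Longrightarrow> h \<in> class_of_one \<alpha> \<Longrightarrow>
      g * h * inv\<^bsub>P\<^esub> g * inv\<^bsub>P\<^esub> h \<in> class_of_one (bcomm \<alpha> \<beta>)"
proof -
  note inv_A = subgroup.m_inv_closed[OF subgroup_class_of_one[OF \<alpha>]]
  note inv_B = subgroup.m_inv_closed[OF subgroup_class_of_one[OF \<beta>]]
  have refl: "(e, e) \<in> bcomm \<alpha> \<beta>" using sg_congruenceD(1) sg_congruence_commutator by blast
  {
    assume g: "g \<in> class_of_one \<alpha>" and h: "h \<in> class_of_one \<beta>"
    let ?g = "inv\<^bsub>P\<^esub> g" and ?h = "inv\<^bsub>P\<^esub> h"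
    have H: "g \<in> H" "h \<in> H" using g h by (auto simp: class_of_one_def)
    have "cmat \<alpha> \<beta> (e * e * e * e) (e * h * e * ?h) (g * e * ?g * e) (g * h * ?g * ?h)"
      using g h inv_A[OF g] inv_B[OF h]
      by (intro cmat_mult cmat1 cmat2) (auto simp: class_of_one_def)
    then have "cmat \<alpha> \<beta> e e e (g * h * ?g * ?h)" using H by simp
    then show "g * h * ?g * ?h \<in> class_of_one (bcomm \<alpha> \<beta>)"
      using cmat_bcomm refl H by (auto simp: class_of_one_def)
  next
    assume g: "g \<in> class_of_one \<beta>" and h: "h \<in> class_of_one \<alpha>"
    let ?g = "inv\<^bsub>P\<^esub> g" and ?h = "inv\<^bsub>P\<^esub> h"
    have H: "g \<in> H" "h \<in> H" using g h by (auto simp: class_of_one_def)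
    have "cmat \<alpha> \<beta> (e * e * e * e) (g * e * ?g * e) (e * h * e * ?h) (g * h * ?g * ?h)"
      using g h inv_B[OF g] inv_A[OF h]
      by (intro cmat_mult cmat1 cmat2) (auto simp: class_of_one_def)
    then have "cmat \<alpha> \<beta> e e e (g * h * ?g * ?h)" using H by simp
    then show "g * h * ?g * ?h \<in> class_of_one (bcomm \<alpha> \<beta>)"
      using cmat_bcomm refl H by (auto simp: class_of_one_def)
  }
qed

lemma class_of_one_Id: "class_of_one Id \<subseteq> {e}" by (auto simp: class_of_one_def)

lemma class_of_one_UNIV: "class_of_one UNIV = H" by (auto simp: class_of_one_def)

lemma derived_subset: "(derived P ^^ d) H \<subseteq> class_of_one (derived_pow d)"
proof (induction d)
  case (Suc d)
  note cong = sg_congruence_derived_pow[of d]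
  have "derived_set P ((derived P ^^ d) H) \<subseteq> class_of_one (derived_pow (Suc d))"
    using group_commutator_in_bcomm(1)[OF cong cong] Suc by auto
  then show ?case
    unfolding funpow.simps o_apply derived_def
    by (intro P.generate_subgroup_incl subgroup_class_of_one sg_congruence_derived_pow)
qed (simp add: class_of_one_UNIV)

text \<open>The shift of the index reflects that \<open>lower_central\<close> starts at 0 and
  \<open>left_pow\<close> at 1.\<close>

lemma lower_central_subset_left: "lower_central P d \<subseteq> class_of_one (left_pow (Suc d))"
proof (induction d)
  case (Suc d)
  note C = group_commutator_in_bcomm(1)[OF sg_congruence_UNIV sg_congruence_left_pow[of "Suc d"]]
  show ?case
    unfolding lower_central.simps
    by (intro P.generate_subgroup_incl subgroup_class_of_one sg_congruence_left_pow)
      (use C Suc class_of_one_UNIV in auto)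
qed (simp add: class_of_one_UNIV)

lemma lower_central_subset_right: "lower_central P d \<subseteq> class_of_one (right_pow (Suc d))"
proof (induction d)
  case (Suc d)
  note C = group_commutator_in_bcomm(2)[OF sg_congruence_right_pow[of "Suc d"] sg_congruence_UNIV]
  show ?case
    unfolding lower_central.simps
    by (intro P.generate_subgroup_incl subgroup_class_of_one sg_congruence_right_pow)
      (use C Suc class_of_one_UNIV in auto)
qed (simp add: class_of_one_UNIV)

lemma solvable_if_derived_pow: "derived_pow d = (Id :: 'a rel) \<Longrightarrow> solvable P"
proof -
  assume "derived_pow d = (Id :: 'a rel)"
  then have "(derived P ^^ d) H \<subseteq> {e}" using derived_subset[of d] class_of_one_Id by simp
  moreover have "e \<in> (derived P ^^ d) H"
    using subgroup.one_closed[OF P.exp_of_derived_is_subgroup[OF P.subgroup_self, of d]] by simp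
  ultimately have "(derived P ^^ d) (carrier P) = {\<one>\<^bsub>P\<^esub>}" by auto
  then show ?thesis using P.solvable_iff_trivial_derived_seq by blast
qed

lemma nilpotent_group_if_lower_central: "lower_central P d \<subseteq> {e} \<Longrightarrow> nilpotent_group P"
proof -
  assume "lower_central P d \<subseteq> {e}"
  moreover have "e \<in> lower_central P d"
    using subgroup.one_closed[OF normal_imp_subgroup[OF P.lower_central_normal[of d]]] by simp
  ultimately have "lower_central P d = {\<one>\<^bsub>P\<^esub>}" by auto
  then show ?thesis unfolding nilpotent_group_def by blast
qed

section \<open>Functions concentrated at the top vertex\<close>

abbreviation top_function :: "nat \<Rightarrow> 'a \<Rightarrow> bool list \<Rightarrow> 'a" where
  "top_function k h \<equiv> (\<lambda>x. if \<forall>i\<le>k. x ! i then h else e)"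

text \<open>The inverse is requested separately because \<open>Mgen\<close> is closed under products
  only.\<close>

definition top_values :: "nat \<Rightarrow> 'a set" where
  "top_values k = {h \<in> H. top_function k h \<in> Mgen (replicate (Suc k) UNIV) \<and>
     top_function k (inv\<^bsub>P\<^esub> h) \<in> Mgen (replicate (Suc k) UNIV)}"

lemma top_function_mult:
  assumes "top_function k g \<in> Mgen (replicate n UNIV)" "top_function k h \<in> Mgen (replicate n UNIV)"
  shows "top_function k (g * h) \<in> Mgen (replicate n UNIV)"
proof -
  have "top_function k (g * h) = (\<lambda>x. top_function k g x * top_function k h x)"
    by (auto simp: fun_eq_iff)
  then show ?thesis using Mgen.mult[OF assms] by simp
qed

lemma subgroup_top_values: "subgroup (top_values k) P"
proof (rule P.subgroupI)
  have "top_function k e = (\<lambda>x. if x ! 0 then e else e)" by auto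
  then have "top_function k e \<in> Mgen (replicate (Suc k) UNIV)"
    using Mgen_replicate_gen[of 0 "Suc k" e e] by simp
  moreover have inv_e: "inv\<^bsub>P\<^esub> e = e" using P.inv_one by simp
  ultimately have "e \<in> top_values k" unfolding top_values_def mem_Collect_eq inv_e by simp
  then show "top_values k \<noteq> {}" by blast
  fix a assume a: "a \<in> top_values k"
  then have inv_a: "inv\<^bsub>P\<^esub> (inv\<^bsub>P\<^esub> a) = a" using P.inv_inv[of a] by (simp add: top_values_def)
  show "inv\<^bsub>P\<^esub> a \<in> top_values k"
    using a unfolding top_values_def mem_Collect_eq inv_a by simp
  fix b assume b: "b \<in> top_values k"
  have inv_ab: "inv\<^bsub>P\<^esub> (a * b) = inv\<^bsub>P\<^esub> b * inv\<^bsub>P\<^esub> a"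
    using a b P.inv_mult_group[of a b] by (simp add: top_values_def)
  show "a \<otimes>\<^bsub>P\<^esub> b \<in> top_values k"
    using a b unfolding top_values_def mem_Collect_eq P_simps inv_ab
    by (simp add: top_function_mult del: replicate_Suc)
qed (auto simp: top_values_def)

text \<open>In the commutator word, g is switched on by the new coordinate and h by the old ones. If
  either is off, the word collapses to \<open>e\<close>. The inverse is the commutator with g and h
  exchanged.\<close>

lemma top_function_commutator:
  assumes g: "g \<in> H" and h: "h \<in> top_values k"
  defines "c \<equiv> g * h * inv\<^bsub>P\<^esub> g * inv\<^bsub>P\<^esub> h"
  shows "c \<in> top_values (Suc k)"
proof -
  let ?g = "inv\<^bsub>P\<^esub> g" and ?h = "inv\<^bsub>P\<^esub> h"
  have H: "h \<in> H" using h by (simp add: top_values_def)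
  have t: "top_function k h \<in> Mgen (replicate (Suc (Suc k)) UNIV)"
    "top_function k ?h \<in> Mgen (replicate (Suc (Suc k)) UNIV)"
    using h Mgen_replicate_mono[of _ "Suc k" "Suc (Suc k)"] by (auto simp: top_values_def)
  define p where "p a x = (if x ! Suc k then a else e)" for a and x :: "bool list"
  have p: "p a \<in> Mgen (replicate (Suc (Suc k)) UNIV)" for a
    unfolding p_def by (rule Mgen_replicate_gen) simp
  have all: "(\<forall>i\<le>Suc k. x ! i) \<longleftrightarrow> x ! Suc k \<and> (\<forall>i\<le>k. x ! i)" for x :: "bool list"
    by (auto simp: le_Suc_eq)
  have "top_function (Suc k) c = (\<lambda>x. p g x * top_function k h x * p ?g x * top_function k ?h x)"
    unfolding all using g H by (intro ext) (auto simp: p_def c_def)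
  then have 1: "top_function (Suc k) c \<in> Mgen (replicate (Suc (Suc k)) UNIV)"
    using t p by (simp only: Mgen.mult)
  have "inv\<^bsub>P\<^esub> c = h * g * ?h * ?g"
    unfolding c_def using g H P.inv_mult_group P.inv_inv by (simp add: mult.assoc)
  then have "top_function (Suc k) (inv\<^bsub>P\<^esub> c) =
      (\<lambda>x. top_function k h x * p g x * top_function k ?h x * p ?g x)"
    unfolding all using g H by (intro ext) (auto simp: p_def)
  then have "top_function (Suc k) (inv\<^bsub>P\<^esub> c) \<in> Mgen (replicate (Suc (Suc k)) UNIV)"
    using t p by (simp only: Mgen.mult)
  moreover have "c \<in> H" using g H by (simp add: c_def)
  ultimately show ?thesis using 1 unfolding top_values_def mem_Collect_eq by blast
qed

lemma lower_central_subset_top_values: "lower_central P k \<subseteq> top_values k"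
proof (induction k)
  case 0
  have "top_function 0 h = (\<lambda>x. if x ! 0 then h else e)" for h by auto
  then show ?case using Mgen_replicate_gen[of 0 "Suc 0"] by (auto simp: top_values_def)
next
  case (Suc k)
  show ?case
    unfolding lower_central.simps
    by (intro P.generate_subgroup_incl subgroup_top_values)
      (use Suc top_function_commutator in auto)
qed

lemma nilpotent_group_if_supernilpotent:
  assumes "commutator (replicate (Suc d) UNIV) = (Id :: 'a rel)"
  shows "nilpotent_group P"
proof (rule nilpotent_group_if_lower_central[of d], rule subsetI)
  fix h assume "h \<in> lower_central P d"
  then have "top_function d h \<in> Mgen (replicate (Suc d) UNIV)"
    using lower_central_subset_top_values[of d] by (auto simp: top_values_def)
  then have "top_function d h (replicate d True @ [False]) = top_function d h (replicate d True @ [True])"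
  proof (rule supernilpotent_term_condition[OF assms])
    fix x :: "bool list" assume x: "length x = d" "x \<noteq> replicate d True"
    then obtain i where "i < d" "\<not> x ! i" by (auto simp: list_eq_iff_nth_eq)
    then have "\<not> (\<forall>i\<le>d. (x @ [b]) ! i)" for b using x by (auto simp: nth_append intro!: exI[of _ i])
    then show "top_function d h (x @ [False]) = top_function d h (x @ [True])"
      by (simp only: if_False)
  qed
  moreover have "\<forall>i\<le>d. (replicate d True @ [True]) ! i" by (auto simp: nth_append)
  moreover have "\<not> (\<forall>i\<le>d. (replicate d True @ [False]) ! i)" by (auto simp: nth_append)
  ultimately show "h \<in> {e}" by simp
qed

end

theorem theorem1p1:
  fixes K :: "('a::semigroup_mult) set"
  assumes "sg_ideal K" and "completely_simple K"
  shows "(sg_solvable TYPE('a) \<longleftrightarrow>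
            nilpotent_extension K \<and>
            (\<forall>H e. H \<subseteq> K \<and> group (sub_group_monoid H e) \<longrightarrow>
                   solvable (sub_group_monoid H e)))
       \<and> (sg_left_nilpotent TYPE('a) \<longleftrightarrow> sg_right_nilpotent TYPE('a))
       \<and> (sg_right_nilpotent TYPE('a) \<longleftrightarrow> sg_supernilpotent TYPE('a))
       \<and> (sg_supernilpotent TYPE('a) \<longleftrightarrow>
            nilpotent_extension K \<and>
            (\<forall>H e. H \<subseteq> K \<and> group (sub_group_monoid H e) \<longrightarrow>
                   nilpotent_group (sub_group_monoid H e)))"
proof -
  obtain e J where "cs_kernel K e J" using completely_simple_cs_kernel[OF assms] by blast
  then interpret cs_kernel K e J .
  let ?sol = "\<forall>H e. H \<subseteq> K \<and> group (sub_group_monoid H e) \<longrightarrow> solvable (sub_group_monoid H e)"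
  let ?nil = "\<forall>H e. H \<subseteq> K \<and> group (sub_group_monoid H e) \<longrightarrow> nilpotent_group (sub_group_monoid H e)"
  have sub: "sub_group_of H e" if "group (sub_group_monoid H e)" for H and e :: 'a
    using that by (rule sub_group_of.intro)
  have "sg_solvable TYPE('a) \<longleftrightarrow> nilpotent_extension K \<and> ?sol"
  proof
    assume "sg_solvable TYPE('a)"
    then obtain d where d: "derived_pow d = (Id :: 'a rel)" unfolding sg_solvable_def by blast
    then have "nilpotent_extension K"
      using reaches_K_pows(1)[of d] nilpotent_extension_if_reaches by auto
    then show "nilpotent_extension K \<and> ?sol"
      using sub_group_of.solvable_if_derived_pow[OF sub d] by blast
  next
    assume "nilpotent_extension K \<and> ?sol"
    \<comment> \<open>The subgroup of \<open>K\<close> to which the assumption is applied is e S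
      e.\<close>
    then show "sg_solvable TYPE('a)"
      unfolding sg_solvable_def using derived_pow_trivial group_G H_subset_K by blast
  qed
  moreover have "sg_left_nilpotent TYPE('a) \<longleftrightarrow> nilpotent_extension K \<and> ?nil"
  proof
    assume "sg_left_nilpotent TYPE('a)"
    then obtain d where d: "left_pow (Suc d) = (Id :: 'a rel)" unfolding sg_left_nilpotent_def by blast
    then have "nilpotent_extension K"
      using reaches_K_pows(2)[of d] nilpotent_extension_if_reaches by auto
    moreover have "nilpotent_group (sub_group_monoid H e)" if "group (sub_group_monoid H e)" for H and e :: 'a
    proof -
      interpret sub_group_of H e using that by (rule sub)
      show ?thesis
        using nilpotent_group_if_lower_central[of d] lower_central_subset_left[of d] class_of_one_Id d by simp
    qed
    ultimately show "nilpotent_extension K \<and> ?nil" by blast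
  next
    assume "nilpotent_extension K \<and> ?nil"
    then show "sg_left_nilpotent TYPE('a)"
      unfolding sg_left_nilpotent_def using nilpotent_pows_trivial(1) group_G H_subset_K by blast
  qed
  moreover have "sg_right_nilpotent TYPE('a) \<longleftrightarrow> nilpotent_extension K \<and> ?nil"
  proof
    assume "sg_right_nilpotent TYPE('a)"
    then obtain d where d: "right_pow (Suc d) = (Id :: 'a rel)" unfolding sg_right_nilpotent_def by blast
    then have "nilpotent_extension K"
      using reaches_K_pows(3)[of d] nilpotent_extension_if_reaches by auto
    moreover have "nilpotent_group (sub_group_monoid H e)" if "group (sub_group_monoid H e)" for H and e :: 'a
    proof -
      interpret sub_group_of H e using that by (rule sub)
      show ?thesis
        using nilpotent_group_if_lower_central[of d] lower_central_subset_right[of d] class_of_one_Id d by simp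
    qed
    ultimately show "nilpotent_extension K \<and> ?nil" by blast
  next
    assume "nilpotent_extension K \<and> ?nil"
    then show "sg_right_nilpotent TYPE('a)"
      unfolding sg_right_nilpotent_def using nilpotent_pows_trivial(2) group_G H_subset_K by blast
  qed
  moreover have "sg_supernilpotent TYPE('a) \<longleftrightarrow> nilpotent_extension K \<and> ?nil"
  proof
    assume "sg_supernilpotent TYPE('a)"
    then obtain d where d: "commutator (replicate (Suc d) UNIV) = (Id :: 'a rel)"
      unfolding sg_supernilpotent_def by blast
    then have "nilpotent_extension K" by (rule nilpotent_extension_if_supernilpotent)
    then show "nilpotent_extension K \<and> ?nil"
      using sub_group_of.nilpotent_group_if_supernilpotent[OF sub d] by blast
  next
    assume "nilpotent_extension K \<and> ?nil"
    then show "sg_supernilpotent TYPE('a)"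
      unfolding sg_supernilpotent_def
      using supernilpotent_if_nilpotent_extension group_G H_subset_K by blast
  qed
  ultimately show ?thesis by blast
qed

end
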